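(* Let $n\ge 3$ be an integer, $a\in[0,1)$, and $p=\frac{2n}{n-2+2a}$. Let $(X,d)$ be a proper metric space and let $\mu$ be a Borel measure on $X$ such that $0<\mu(U)<\infty$ for every nonempty bounded open set $U\subset X$. Let $x_0\in X$, $C\ge K_a$ and $C_0\ge 1$, where $K_a$ is the explicit constant given in the context. Assume that: (i) (Caffarelli-Kohn-Nirenberg inequality) $$\left(\int_X \frac{|u(x)|^p}{d(x_0,x)^{ap}}\,d\mu(x)\right)^{1/p}\le C\left(\int_X |Du|(x)^2\,d\mu(x)\right)^{1/2}\quad\text{for all } u\in \mathrm{Lip}_0(X);$$ (ii) $\displaystyle \frac{\mu(B(x,R))}{\mu(B(x,r))}\le C_0\left(\frac{R}{r}\right)^n$ for all $x\in X$ and all $0<r<R$; (iii) $\displaystyle \liminf_{r\to 0}\frac{\mu(B(x_0,r))}{\mu_E(\mathbb B_n(r))}=1$. Then for every $x\in X$ and every $\rho>0$, $$\mu(B(x,\rho))\ge C_0^{-1}\,(C^{-1}K_a)^{\frac{n}{1-a}}\,\mu_E(\mathbb B_n(\rho)).$$ In particular, $(X,d,\mu)$ has the $n$-dimensional volume growth $$C_0^{-1}(C^{-1}K_a)^{\frac{n}{1-a}}\omega_n\rho^n\le \mu(B(x_0,\rho))\le C_0\,\omega_n\rho^n\quad\text{for all }\rho>0.$$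
   Context: A metric space is proper if all its closed bounded subsets are compact. $B(x,r)=\{y\in X: d(x,y)<r\}$ is the open ball in $X$; $\mathbb B_n(r)=\{x\in\mathbb R^n:|x|<r\}$; $\mu_E$ is the $n$-dimensional Lebesgue measure on $\mathbb R^n$; $\omega_n=\pi^{n/2}/\Gamma(n/2+1)$ is the volume of the unit ball in $\mathbb R^n$. $\mathrm{Lip}_0(X)$ is the space of (real-valued) Lipschitz functions with compact support on $X$, and $$|Du|(x):=\limsup_{y\to x}\frac{|u(y)-u(x)|}{d(x,y)}$$ is the local Lipschitz constant of $u$ at $x$. The constant $K_a$ (the optimal constant in the Euclidean Caffarelli-Kohn-Nirenberg inequality) is $$K_a:=\left(\frac{1}{(n-2)(n-ap)}\right)^{\frac12}\left(\frac{(2-ap)\,\Gamma\!\left(\frac{2n-2ap}{2-ap}\right)}{n\omega_n\,\Gamma\!\left(\frac{n-ap}{2-ap}\right)^2}\right)^{\frac{2-ap}{2n-2ap}}.$$ *)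

theory Defs
  imports "HOL-Analysis.Analysis"
begin

definition proper_space :: "'a::metric_space itself \<Rightarrow> bool" where
  "proper_space (_ :: 'a itself) \<longleftrightarrow> (\<forall>S :: 'a set. closed S \<longrightarrow> bounded S \<longrightarrow> compact S)"

definition Lip0 :: "('a::metric_space \<Rightarrow> real) set" where
  "Lip0 = {u. (\<exists>L. L-lipschitz_on UNIV u) \<and> compact (closure {x. u x \<noteq> 0})}"

text \<open>The local Lipschitz constant $|Du|(x)$. The limsup runs over $y \neq x$; at an isolated
  point the filter \<^term>\<open>at x\<close> is trivial and the value is \<open>0\<close>, the least
  element of \<^typ>\<open>ennreal\<close>.\<close>
definition local_lip :: "('a::metric_space \<Rightarrow> real) \<Rightarrow> 'a \<Rightarrow> ennreal" where
  "local_lip u x = Limsup (at x) (\<lambda>y. ennreal (\<bar>u y - u x\<bar> / dist x y))"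

text \<open>Power of an extended nonnegative number; only used for exponents \<open>s > 0\<close>.\<close>
definition enn_powr :: "ennreal \<Rightarrow> real \<Rightarrow> ennreal" where
  "enn_powr t s = (if t = \<infinity> then \<infinity> else ennreal (enn2real t powr s))"

text \<open>The weight $t^s$ for \<open>t \<ge> 0\<close> with the convention $0^0 = 1$ (whereas
  \<^term>\<open>(0::real) powr 0\<close> is \<open>0\<close>), so that the weight is constantly \<open>1\<close>
  in the case \<open>a = 0\<close>.\<close>
definition weight_powr :: "real \<Rightarrow> real \<Rightarrow> real" where
  "weight_powr t s = (if s = 0 then 1 else t powr s)"

text \<open>The inequality is read in $[0,\infty]$; division is the one of \<^typ>\<open>ennreal\<close>,
  i.e. \<open>c / 0 = \<infinity>\<close> for \<open>c > 0\<close> and \<open>0 / 0 = 0\<close>, which only concerns the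
  point \<open>x = x\<^sub>0\<close>.\<close>
definition CKN_inequality ::
    "'a::metric_space measure \<Rightarrow> 'a \<Rightarrow> real \<Rightarrow> real \<Rightarrow> real \<Rightarrow> bool" where
  "CKN_inequality M x\<^sub>0 a p C \<longleftrightarrow>
     (\<forall>u \<in> Lip0.
        enn_powr (\<integral>\<^sup>+x. ennreal (\<bar>u x\<bar> powr p) / ennreal (weight_powr (dist x\<^sub>0 x) (a * p)) \<partial>M) (1 / p)
        \<le> ennreal C * enn_powr (\<integral>\<^sup>+x. (local_lip u x)\<^sup>2 \<partial>M) (1 / 2))"

text \<open>Here $\omega_n$ is \<^term>\<open>unit_ball_vol (real n)\<close>.\<close>
definition CKN_const :: "nat \<Rightarrow> real \<Rightarrow> real \<Rightarrow> real" where
  "CKN_const n a p =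
     (1 / ((real n - 2) * (real n - a * p))) powr (1 / 2) *
     (((2 - a * p) * Gamma ((2 * real n - 2 * a * p) / (2 - a * p))) /
      (real n * unit_ball_vol (real n) * (Gamma ((real n - a * p) / (2 - a * p)))\<^sup>2))
       powr ((2 - a * p) / (2 * real n - 2 * a * p))"

end

theory Submission
  imports Defs
begin

text \<open>
  The inequality is tested on the functions $u_\lambda = (\lambda + d^s)^{-k}$, where
  $d = d(x_0,\cdot)$, which are extremal for the Euclidean inequality. Write $q = ap$, $s = 2 - q$,
  $N = n/(1-a)$ and $k = N/2 - 1$; then $n - 2 = sk$, $n - q = sN/2$ and $pk = N$. Put
  $$G(\lambda) = \int d^{-q} (\lambda + d^s)^{1-N} \, d\mu, \qquad
    J(\lambda) = \int d^{-q} (\lambda + d^s)^{-N} \, d\mu .$$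
  Since $d$ is 1-Lipschitz, the gradient integral of $u_\lambda$ is at most $(n-2)^2$ times
  $\int d^{s-q} (\lambda + d^s)^{-N} d\mu = G - \lambda J$, while the left-hand integral is $J$. As
  $G' = -(N-1) J$, the inequality becomes a differential inequality for $G$ alone:
  $$J^{1 - 2/N} \le C^2 (n-2)^2 \, (G - \lambda J) .$$
  For Lebesgue measure the analogue of $G$ is $\Gamma \lambda^{-k}$ with an explicit $\Gamma$, and
  $\kappa \Gamma \lambda^{-k}$ with $\kappa = (K_a/C)^N$ solves the corresponding
  differential equation; this is where the formula for $K_a$ enters (\<open>CKN_const_critical\<close>).

  The density assumption at $x_0$ says that $G$ is asymptotically at least $\Gamma \lambda^{-k}$ as
  $\lambda \to 0$, so for $\kappa < 1$ the function $G$ starts above the solution. A comparison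
  argument (\<open>ode_comparison\<close>) keeps it above for all $\lambda$. Letting
  $\lambda \to \infty$, the behaviour of $G$ is governed by the volume of large balls: if
  $\mu(B(x_0,R)) \le c \, \omega_n R^n$ for all large $R$, then $G \le (c + o(1)) \Gamma
  \lambda^{-k}$. Hence for every $c < \kappa$ there are arbitrarily large $R$ with
  $\mu(B(x_0,R)) > c \, \omega_n R^n$ (\<open>volume_growth_at_infinity\<close>). The volume
  comparison of concentric balls carries this from large balls to all balls and all centres, at the price of the
  factor $C_0^{-1}$ (\<open>measure_ball_ge_of_growth\<close>). The case $C = K_a$ follows by applying
  the argument to $C' > C$ and letting $C' \to C$. The upper bound is the same volume
  comparison with balls shrinking to $x_0$, where the density is known.

  Two devices keep the measure theory light. Integrals of decreasing functions of the distance are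
  compared by comparing volumes of balls (\<open>radial_integral_mono\<close>), and the Euclidean side is
  replaced by a weighted measure on the unit interval that depends on $\lambda$, has the same
  volumes of balls, and turns the radial integral into a Beta integral without substitution.
\<close>

section \<open>Differentiating the bubble integral\<close>

text \<open>Convexity of $y \mapsto y^{-e}$, obtained without second derivatives from $\ln z \le z - 1$ and
  $1 + u \le e^u$ with $z = y/x$.\<close>

lemma powr_neg_tangent:
  fixes e x y :: real
  assumes "e \<ge> 0" "x > 0" "y > 0"
  shows "y powr (-e) \<ge> x powr (-e) - e * x powr (-e - 1) * (y - x)"
proof -
  have "1 - e * (y / x - 1) \<le> 1 - e * ln (y / x)"
    using assms ln_le_minus_one[of "y / x"] by (simp add: mult_left_mono)
  also have "\<dots> \<le> exp (- e * ln (y / x))"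
    using exp_ge_add_one_self[of "- e * ln (y / x)"] by simp
  also have "\<dots> = (y / x) powr (-e)"
    using assms by (simp add: powr_def)
  finally have "x powr (-e) * (1 - e * (y / x - 1)) \<le> x powr (-e) * (y / x) powr (-e)"
    by (intro mult_left_mono) auto
  also have "\<dots> = y powr (-e)"
    using assms by (simp flip: powr_mult)
  also have "x powr (-e) * (1 - e * (y / x - 1)) = x powr (-e) - e * x powr (-e - 1) * (y - x)"
    using assms by (simp add: powr_diff field_simps)
  finally show ?thesis .
qed

text \<open>Differentiation under the integral sign without a dominating function. Integrating the
  tangent inequality shows that \<open>- (N - 1) * J l\<close> is a subgradient of the convex function
  $G(l) = \int w (l + D)^{1-N}$ at every point; and a function with a continuous choice of subgradients
  is differentiable. Continuity of $J(l) = \int w (l + D)^{-N}$ comes from the pointwise bound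
  $m + D \ge \min(1, m/l) (l + D)$, used in both directions.\<close>

lemma power_integral_has_derivative:
  fixes w D :: "'a \<Rightarrow> real" and N l :: real
  assumes N: "N > 1" and l: "l > 0"
    and [measurable]: "w \<in> borel_measurable M" "D \<in> borel_measurable M"
    and w: "\<And>x. w x \<ge> 0" and D: "\<And>x. D x \<ge> 0"
    and int: "\<And>l. l > 0 \<Longrightarrow> integrable M (\<lambda>x. w x * (l + D x) powr (1 - N))"
  shows "((\<lambda>l. \<integral>x. w x * (l + D x) powr (1 - N) \<partial>M) has_real_derivative
            - (N - 1) * (\<integral>x. w x * (l + D x) powr (- N) \<partial>M)) (at l)"
proof -
  define G where "G l = (\<integral>x. w x * (l + D x) powr (1 - N) \<partial>M)" for l
  define J where "J l = (\<integral>x. w x * (l + D x) powr (- N) \<partial>M)" for l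
  have pos: "l + D x > 0" if "l > 0" for l x using D[of x] that by linarith
  have intJ: "integrable M (\<lambda>x. w x * (l + D x) powr (- N))" if "l > 0" for l
  proof (rule Bochner_Integration.integrable_bound)
    show "integrable M (\<lambda>x. (w x * (l + D x) powr (1 - N)) / l)"
      using int[OF that] by (rule integrable_divide)
    have "(l + D x) powr (- N) \<le> (l + D x) powr (1 - N) / l" for x
      using that D[of x] pos[OF that, of x] by (simp add: powr_diff powr_minus field_simps)
    then have "w x * (l + D x) powr (- N) \<le> w x * (l + D x) powr (1 - N) / l" for x
      using mult_left_mono[OF _ w] by (metis times_divide_eq_right)
    then show "AE x in M. norm (w x * (l + D x) powr (- N)) \<le> norm (w x * (l + D x) powr (1 - N) / l)"
      using w that by (auto simp: abs_mult)
  qed measurable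
  \<comment> \<open>the subgradient inequality; exchanging its two points bounds the difference from the other side\<close>
  have sub: "G m \<ge> G l - (N - 1) * J l * (m - l)" if "l > 0" "m > 0" for l m
  proof -
    have "G l - (N - 1) * J l * (m - l) =
       (\<integral>x. w x * (l + D x) powr (1 - N) - (N - 1) * (m - l) * (w x * (l + D x) powr (- N)) \<partial>M)"
      unfolding G_def J_def using int[OF that(1)] intJ[OF that(1)] by simp
    also have "\<dots> \<le> G m"
      unfolding G_def
    proof (rule integral_mono)
      fix x
      have "(m + D x) powr (1 - N) \<ge>
          (l + D x) powr (1 - N) - (N - 1) * (l + D x) powr (- N) * (m - l)"
        using powr_neg_tangent[of "N - 1" "l + D x" "m + D x"] pos that N by simp
      from mult_left_mono[OF this w[of x]]
      show "w x * (l + D x) powr (1 - N) - (N - 1) * (m - l) * (w x * (l + D x) powr (- N)) \<le> 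
            w x * (m + D x) powr (1 - N)"
        by (simp add: algebra_simps)
    qed (use that int intJ in auto)
    finally show ?thesis .
  qed
  have Jle: "J m \<le> (min 1 (m / l)) powr (- N) * J l" if "l > 0" "m > 0" for l m
  proof -
    have "J m \<le> (\<integral>x. (min 1 (m / l)) powr (- N) * (w x * (l + D x) powr (- N)) \<partial>M)"
      unfolding J_def
    proof (rule integral_mono)
      fix x
      have "min 1 (m / l) * (l + D x) \<le> m + D x"
      proof -
        have "min 1 (m / l) * l \<le> m" using that by (simp add: min_def field_simps)
        moreover have "min 1 (m / l) * D x \<le> 1 * D x" by (intro mult_right_mono D) auto
        ultimately show ?thesis by (simp add: algebra_simps)
      qed
      then have "(m + D x) powr (- N) \<le> (min 1 (m / l) * (l + D x)) powr (- N)"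
        using that pos N by (intro powr_mono2') auto
      also have "\<dots> = (min 1 (m / l)) powr (- N) * (l + D x) powr (- N)"
        using that pos[of l x] by (simp add: powr_mult)
      finally show "w x * (m + D x) powr (- N) \<le> (min 1 (m / l)) powr (- N) * (w x * (l + D x) powr (- N))"
        using mult_left_mono[OF _ w[of x]] by (metis mult.left_commute)
    qed (use that intJ in auto)
    also have "\<dots> = (min 1 (m / l)) powr (- N) * J l" by (simp add: J_def)
    finally show ?thesis .
  qed
  have ev: "eventually (\<lambda>m. m > 0) (at l)"
    using l by (intro order_tendstoD(1)[of _ l]) auto
  have "((\<lambda>m. J m) \<longlongrightarrow> J l) (at l)"
  proof (rule tendsto_sandwich)
    show "eventually (\<lambda>m. J m \<le> (min 1 (m / l)) powr (- N) * J l) (at l)"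
      using ev by eventually_elim (use Jle l in auto)
    show "eventually (\<lambda>m. (min 1 (l / m)) powr N * J l \<le> J m) (at l)"
      using ev
    proof eventually_elim
      case (elim m)
      have "J l \<le> (min 1 (l / m)) powr (- N) * J m" using Jle[of m l] elim l by auto
      then have "(min 1 (l / m)) powr N * J l \<le> (min 1 (l / m)) powr N * ((min 1 (l / m)) powr (- N) * J m)"
        by (intro mult_left_mono) auto
      also have "\<dots> = J m" using elim l by (auto simp: min_def simp flip: mult.assoc powr_add)
      finally show ?case .
    qed
    have "((\<lambda>m. (min 1 (m / l)) powr (- N) * J l) \<longlongrightarrow> (min 1 (l / l)) powr (- N) * J l) (at l)"
      using l by (intro tendsto_intros) auto
    then show "((\<lambda>m. (min 1 (m / l)) powr (- N) * J l) \<longlongrightarrow> J l) (at l)"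
      using l by simp
    have "((\<lambda>m. (min 1 (l / m)) powr N * J l) \<longlongrightarrow> (min 1 (l / l)) powr N * J l) (at l)"
      using l by (intro tendsto_intros) auto
    then show "((\<lambda>m. (min 1 (l / m)) powr N * J l) \<longlongrightarrow> J l) (at l)"
      using l by simp
  qed
  then have "((\<lambda>m. (N - 1) * (J m - J l)) \<longlongrightarrow> (N - 1) * (J l - J l)) (at l)"
    by (intro tendsto_intros)
  then have lim0: "((\<lambda>m. (N - 1) * (J m - J l)) \<longlongrightarrow> 0) (at l)" by simp
  have "((\<lambda>m. (G m - G l) / (m - l) + (N - 1) * J l) \<longlongrightarrow> 0) (at l)"
  proof (rule Lim_null_comparison)
    show "((\<lambda>m. \<bar>(N - 1) * (J m - J l)\<bar>) \<longlongrightarrow> 0) (at l)" using lim0 by (rule tendsto_rabs_zero)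
    have "eventually (\<lambda>m. m \<noteq> l) (at l)" by (simp add: eventually_at_filter)
    with ev show "eventually (\<lambda>m. norm ((G m - G l) / (m - l) + (N - 1) * J l) \<le> \<bar>(N - 1) * (J m - J l)\<bar>) (at l)"
    proof eventually_elim
      case (elim m)
      have 1: "G m - G l + (N - 1) * J l * (m - l) \<ge> 0" using sub[of l m] elim l by simp
      have 2: "G m - G l + (N - 1) * J l * (m - l) \<le> - ((N - 1) * (J m - J l) * (m - l))"
        using sub[of m l] elim l by (simp add: algebra_simps)
      have "(G m - G l) / (m - l) + (N - 1) * J l = (G m - G l + (N - 1) * J l * (m - l)) / (m - l)"
        using elim by (simp add: field_simps)
      also have "\<bar>\<dots>\<bar> = \<bar>G m - G l + (N - 1) * J l * (m - l)\<bar> / \<bar>m - l\<bar>"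
        by simp
      also have "\<dots> \<le> (\<bar>(N - 1) * (J m - J l)\<bar> * \<bar>m - l\<bar>) / \<bar>m - l\<bar>"
        using 1 2 by (intro divide_right_mono) (auto simp flip: abs_mult)
      also have "\<dots> = \<bar>(N - 1) * (J m - J l)\<bar>" using elim by simp
      finally show ?case by simp
    qed
  qed
  from tendsto_add[OF this tendsto_const[of "- ((N - 1) * J l)"]]
  have "((\<lambda>m. (G m - G l) / (m - l)) \<longlongrightarrow> - (N - 1) * J l) (at l)" by (simp add: left_diff_distrib right_diff_distrib)
  then show ?thesis
    by (simp add: has_field_derivative_iff G_def J_def)
qed


section \<open>Comparison for the differential inequality\<close>

text \<open>The function \<open>b * l powr (- k)\<close> satisfies the differential inequality with equality,
  by the choice of \<open>b\<close> in \<open>crit\<close>. Both sides of the inequality are monotone in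
  \<open>J\<close> in opposite directions, so wherever \<open>G\<close> lies below this solution it also
  decreases more slowly. Going from such a point towards 0, the gap can therefore only widen, and
  \<open>G\<close> stays below the solution all the way to 0, against its behaviour there. The strict
  inequality \<open>b' > b\<close> is essential: a gap that merely fails to close is no
  contradiction, because the solution itself blows up at 0.\<close>

lemma ode_comparison:
  fixes G J :: "real \<Rightarrow> real" and A N k b b' :: real
  assumes A: "A > 0" and N: "N > 2" and k: "k = N / 2 - 1" and b: "b > 0" and b': "b' > b"
    and G: "\<And>l. l > 0 \<Longrightarrow> (G has_real_derivative - (N - 1) * J l) (at l)"
    and ode: "\<And>l. l > 0 \<Longrightarrow> J l powr (1 - 2 / N) \<le> A * (G l - l * J l)"
    and crit: "(k * b / (N - 1)) powr (1 - 2 / N) = A * (b - k * b / (N - 1))"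
    and lim: "eventually (\<lambda>l. G l \<ge> b' * l powr (- k)) (at_right 0)"
    and l: "l > 0"
  shows "G l \<ge> b * l powr (- k)"
proof (rule ccontr)
  assume less: "\<not> G l \<ge> b * l powr (- k)"
  define E where "E l = b * l powr (- k)" for l
  define JE where "JE l = k * b / (N - 1) * l powr (- k - 1)" for l
  define \<Delta> where "\<Delta> l = G l - E l" for l
  have kpos: "k > 0" and N1: "N - 1 > 0" using N k by auto
  have E: "(E has_real_derivative - (N - 1) * JE l) (at l)" if "l > 0" for l
  proof -
    have "((\<lambda>l. b * l powr (- k)) has_real_derivative b * ((- k) * l powr (- k - 1))) (at l)"
      using that by (intro DERIV_cmult DERIV_powr) (auto intro!: derivative_eq_intros)
    moreover have "b * ((- k) * l powr (- k - 1)) = - (N - 1) * JE l"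
      using N1 by (simp add: JE_def field_simps)
    ultimately show ?thesis by (simp add: E_def[abs_def])
  qed
  have odeE: "JE l powr (1 - 2 / N) = A * (E l - l * JE l)" if "l > 0" for l
  proof -
    have e: "(- k - 1) * (1 - 2 / N) = - k" using N k by (simp add: field_simps)
    have "JE l powr (1 - 2 / N) = (k * b / (N - 1)) powr (1 - 2 / N) * l powr (- k)"
      unfolding JE_def using that kpos N1 b by (subst powr_mult) (auto simp: powr_powr e)
    also have "\<dots> = A * (b - k * b / (N - 1)) * l powr (- k)" by (simp only: crit)
    also have "\<dots> = A * (E l - l * JE l)"
    proof -
      have "l * l powr (- k - 1) = l powr (- k)" using that by (simp add: powr_diff)
      then have "l * JE l = k * b / (N - 1) * l powr (- k)"
        by (simp add: JE_def mult.left_commute[of l])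
      then show ?thesis by (simp add: E_def left_diff_distrib)
    qed
    finally show ?thesis .
  qed
  have JJ: "J l < JE l" if "l > 0" "\<Delta> l < 0" for l
  proof (rule ccontr)
    assume "\<not> J l < JE l"
    then have ge: "J l \<ge> JE l" by simp
    have "JE l \<ge> 0" using b kpos N1 by (simp add: JE_def)
    then have "A * (E l - l * JE l) \<le> J l powr (1 - 2 / N)"
      unfolding odeE[OF that(1), symmetric] using ge N by (intro powr_mono2) auto
    also have "\<dots> \<le> A * (G l - l * J l)" using ode that by simp
    finally have "E l - l * JE l \<le> G l - l * J l" using A by simp
    moreover have "l * JE l \<le> l * J l" using ge that by simp
    moreover have "G l < E l" using that by (simp add: \<Delta>_def)
    ultimately show False by linarith
  qed
  have D: "(\<Delta> has_real_derivative (N - 1) * (JE l - J l)) (at l)" if "l > 0" for l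
    unfolding \<Delta>_def[abs_def] using DERIV_diff[OF G[OF that] E[OF that]] by (simp add: algebra_simps)
  have cont: "continuous_on {0<..} \<Delta>"
    by (intro DERIV_continuous_on[where D = "\<lambda>l. (N - 1) * (JE l - J l)"])
       (auto intro: D has_field_derivative_at_within)
  have neg: "\<Delta> l < 0" using less by (simp add: \<Delta>_def E_def)
  have all_neg: "\<Delta> m < 0" if m: "0 < m" "m < l" for m
  proof (rule ccontr)
    assume nn: "\<not> \<Delta> m < 0"
    \<comment> \<open>the last point before \<open>l\<close> at which \<open>G\<close> is not below the solution\<close>
    define S where "S = {x \<in> {m..l}. \<Delta> x \<ge> 0}"
    have cml: "continuous_on {m..l} \<Delta>" using m by (intro continuous_on_subset[OF cont]) auto
    have "closed S" unfolding S_def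
      using continuous_on_closed_Collect_le[of "{m..l}" "\<lambda>_. 0" \<Delta>] cml by auto
    moreover have "bounded S" unfolding S_def by (rule bounded_subset[of "{m..l}"]) auto
    ultimately have "compact S" by (simp add: compact_eq_bounded_closed)
    moreover have "m \<in> S" using nn m by (simp add: S_def)
    ultimately obtain z where z: "z \<in> S" "\<And>y. y \<in> S \<Longrightarrow> y \<le> z"
      using compact_attains_sup[of S] by auto
    have zl: "z < l" "z > 0" using z(1) neg m by (auto simp: S_def le_less)
    have n: "\<Delta> y < 0" if "z < y" "y \<le> l" for y
      using z(2)[of y] z(1) that by (force simp: S_def)
    have "\<exists>y. y > z \<and> y < l \<and> \<Delta> l - \<Delta> z = (l - z) * ((N - 1) * (JE y - J y))"
      using zl by (intro MVT2) (auto intro: D)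
    then obtain y where y: "y > z" "y < l" "\<Delta> l - \<Delta> z = (l - z) * ((N - 1) * (JE y - J y))" by auto
    have "JE y > J y" using JJ[of y] n[of y] y zl by auto
    then have "\<Delta> l - \<Delta> z > 0" using y zl N1 by simp
    moreover have "\<Delta> z \<ge> 0" using z(1) by (simp add: S_def)
    ultimately show False using neg by simp
  qed
  have "eventually (\<lambda>m. m \<in> {0<..<l}) (at_right 0)"
    using l by (intro eventually_at_right_real)
  with lim have "eventually (\<lambda>m. False) (at_right (0::real))"
  proof eventually_elim
    case (elim m)
    then have "b' * m powr (- k) < b * m powr (- k)"
    proof -
      have "G m < b * m powr (- k)" using all_neg[of m] elim by (simp add: \<Delta>_def E_def)
      with elim show ?thesis by linarith
    qed
    moreover have "b * m powr (- k) \<le> b' * m powr (- k)"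
      using b' by (intro mult_right_mono) auto
    ultimately show False by linarith
  qed
  then show False by simp
qed

section \<open>Radial integrals and volumes of balls\<close>

text \<open>Tonelli's theorem for the region under the graph of \<open>g\<close>.\<close>

lemma nn_integral_layer_cake:
  fixes g :: "'a \<Rightarrow> real"
  assumes "sigma_finite_measure M" and [measurable]: "g \<in> borel_measurable M"
    and g: "\<And>x. x \<in> space M \<Longrightarrow> g x \<ge> 0"
  shows "(\<integral>\<^sup>+x. ennreal (g x) \<partial>M) =
           (\<integral>\<^sup>+t. emeasure M {x \<in> space M. t < g x} * indicator {0<..} t \<partial>lborel)"
proof -
  interpret sigma_finite_measure M by fact
  interpret P: pair_sigma_finite M lborel ..
  let ?S = "\<lambda>x t. indicator {t. 0 < t \<and> t < g x} t :: ennreal"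
  have "(\<integral>\<^sup>+x. ennreal (g x) \<partial>M) = (\<integral>\<^sup>+x. (\<integral>\<^sup>+t. ?S x t \<partial>lborel) \<partial>M)"
  proof (rule nn_integral_cong)
    fix x assume "x \<in> space M"
    have "{t. 0 < t \<and> t < g x} = {0<..<g x}" by auto
    then show "ennreal (g x) = (\<integral>\<^sup>+t. ?S x t \<partial>lborel)"
      using g[OF \<open>x \<in> space M\<close>] by simp
  qed
  also have "\<dots> = (\<integral>\<^sup>+t. (\<integral>\<^sup>+x. ?S x t \<partial>M) \<partial>lborel)"
    by (rule P.Fubini'[symmetric]) (simp add: indicator_def)
  also have "\<dots> = (\<integral>\<^sup>+t. emeasure M {x \<in> space M. t < g x} * indicator {0<..} t \<partial>lborel)"
  proof (rule nn_integral_cong)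
    fix t :: real
    have "(\<integral>\<^sup>+x. ?S x t \<partial>M) = (\<integral>\<^sup>+x. indicator {0<..} t * indicator {x \<in> space M. t < g x} x \<partial>M)"
      by (rule nn_integral_cong) (auto simp: indicator_def)
    also have "\<dots> = indicator {0<..} t * emeasure M {x \<in> space M. t < g x}"
      by (subst nn_integral_cmult) auto
    finally show "(\<integral>\<^sup>+x. ?S x t \<partial>M) = emeasure M {x \<in> space M. t < g x} * indicator {0<..} t"
      by (simp add: mult.commute)
  qed
  finally show ?thesis .
qed

text \<open>The superlevel sets of a decreasing function of the distance are balls, so by the layer-cake
  formula only the volumes of these balls matter. Right lower semicontinuity makes every superlevel
  set of \<open>\<phi>\<close> in $(0,\infty)$ an open interval \<open>(0, \<rho>)\<close>, and decay makes
  \<open>\<rho>\<close> finite. The volume comparison is required only at radii \<open>\<rho>\<close> that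
  arise in this way: for a \<open>\<phi>\<close> cut off at a radius these are the small ones, and for
  one that is constant near 0 they are the large ones.\<close>

lemma radial_integral_mono:
  fixes d :: "'a \<Rightarrow> real" and d' :: "'b \<Rightarrow> real" and \<phi> :: "real \<Rightarrow> real" and c :: ennreal
  assumes M: "sigma_finite_measure M" "sigma_finite_measure M'"
    and [measurable]: "d \<in> borel_measurable M" "d' \<in> borel_measurable M'"
      "\<phi> \<in> borel_measurable borel"
    and d: "AE x in M. d x > 0" "AE x in M'. d' x > 0"
    and nonneg: "\<And>r. \<phi> r \<ge> 0"
    and anti: "\<And>r r'. 0 < r \<Longrightarrow> r \<le> r' \<Longrightarrow> \<phi> r' \<le> \<phi> r"
    and rlsc: "\<And>r t. 0 < r \<Longrightarrow> 0 < t \<Longrightarrow> t < \<phi> r \<Longrightarrow> \<exists>r'>r. t < \<phi> r'"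
    and decay: "\<And>t. 0 < t \<Longrightarrow> \<exists>R>0. \<phi> R \<le> t"
    and vol: "\<And>\<rho> t. 0 < \<rho> \<Longrightarrow> 0 < t \<Longrightarrow> (\<And>r. 0 < r \<Longrightarrow> t < \<phi> r \<longleftrightarrow> r < \<rho>) \<Longrightarrow>
       emeasure M {x \<in> space M. d x < \<rho>} \<le> c * emeasure M' {x \<in> space M'. d' x < \<rho>}"
  shows "(\<integral>\<^sup>+x. ennreal (\<phi> (d x)) \<partial>M) \<le> c * (\<integral>\<^sup>+x. ennreal (\<phi> (d' x)) \<partial>M')"
proof -
  have level: "emeasure M {x \<in> space M. t < \<phi> (d x)} \<le> c * emeasure M' {x \<in> space M'. t < \<phi> (d' x)}"
    if t: "t > 0" for t
  proof (cases "\<exists>r>0. t < \<phi> r")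
    case False
    then have "AE x in M. \<not> t < \<phi> (d x)" using d(1) by auto
    then have "emeasure M {x \<in> space M. t < \<phi> (d x)} = 0"
      by (subst (asm) AE_iff_measurable[OF _ refl]) auto
    then show ?thesis by simp
  next
    case True
    define S where "S = {r. 0 < r \<and> t < \<phi> r}"
    obtain R where R: "R > 0" "\<phi> R \<le> t" using decay t by blast
    have bdd: "bdd_above S"
    proof (rule bdd_aboveI)
      fix r assume "r \<in> S"
      then show "r \<le> R" using anti[of R r] R by (force simp: S_def)
    qed
    define \<rho> where "\<rho> = Sup S"
    have iff: "t < \<phi> r \<longleftrightarrow> r < \<rho>" if "r > 0" for r
    proof
      assume "t < \<phi> r"
      from rlsc[OF that t this] obtain r' where "r' > r" "t < \<phi> r'" by auto
      then have "r' \<le> \<rho>" unfolding \<rho>_def using that by (intro cSup_upper bdd) (auto simp: S_def)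
      then show "r < \<rho>" using \<open>r' > r\<close> by simp
    next
      assume "r < \<rho>"
      then obtain r' where "r' \<in> S" "r < r'"
        using True less_cSup_iff[OF _ bdd, of r] by (auto simp: S_def \<rho>_def)
      then show "t < \<phi> r" using anti[of r r'] that by (force simp: S_def)
    qed
    have "\<rho> > 0" using True iff by fastforce
    have "emeasure M {x \<in> space M. t < \<phi> (d x)} = emeasure M {x \<in> space M. d x < \<rho>}"
      using d(1) by (intro emeasure_eq_AE) (auto simp: iff)
    also have "\<dots> \<le> c * emeasure M' {x \<in> space M'. d' x < \<rho>}"
      using vol[OF \<open>\<rho> > 0\<close> t iff] by simp
    also have "emeasure M' {x \<in> space M'. d' x < \<rho>} = emeasure M' {x \<in> space M'. t < \<phi> (d' x)}"
      using d(2) by (intro emeasure_eq_AE) (auto simp: iff)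
    finally show ?thesis .
  qed
  interpret M': sigma_finite_measure M' by fact
  have m: "(\<lambda>t. emeasure M' {x \<in> space M'. t < \<phi> (d' x)}) \<in> borel_measurable lborel"
  proof -
    have "{p \<in> space (lborel \<Otimes>\<^sub>M M'). fst p < \<phi> (d' (snd p))} \<in> sets (lborel \<Otimes>\<^sub>M M')" by measurable
    from M'.measurable_emeasure_Pair[OF this] show ?thesis
      by (simp add: space_pair_measure vimage_def)
  qed
  have "(\<integral>\<^sup>+x. ennreal (\<phi> (d x)) \<partial>M) =
      (\<integral>\<^sup>+t. emeasure M {x \<in> space M. t < \<phi> (d x)} * indicator {0<..} t \<partial>lborel)"
    by (intro nn_integral_layer_cake M nonneg) auto
  also have "\<dots> \<le> (\<integral>\<^sup>+t. c * (emeasure M' {x \<in> space M'. t < \<phi> (d' x)} * indicator {0<..} t) \<partial>lborel)"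
    by (intro nn_integral_mono) (auto simp: indicator_def level)
  also have "\<dots> = c * (\<integral>\<^sup>+t. emeasure M' {x \<in> space M'. t < \<phi> (d' x)} * indicator {0<..} t \<partial>lborel)"
    using m by (intro nn_integral_cmult) auto
  also have "(\<integral>\<^sup>+t. emeasure M' {x \<in> space M'. t < \<phi> (d' x)} * indicator {0<..} t \<partial>lborel) =
     (\<integral>\<^sup>+x. ennreal (\<phi> (d' x)) \<partial>M')"
    by (intro nn_integral_layer_cake[symmetric] M nonneg) auto
  finally show ?thesis .
qed

section \<open>A model of Euclidean radial measure on the unit interval\<close>

text \<open>With \<open>e = m / s\<close>, the map \<open>model_radius s l\<close> pushes this measure forward to
  the radial part $v\, m\, r^{m-1} dr$ of a multiple of Lebesgue measure in dimension \<open>m\<close>,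
  the normalisation being that balls have volume $v r^m$. The coordinate is
  $t = r^s / (l + r^s)$, which is adapted to the bubble with parameter \<open>l\<close>.\<close>

definition model_measure :: "real \<Rightarrow> real \<Rightarrow> real \<Rightarrow> real measure" where
  "model_measure v e l = density lborel (\<lambda>t. ennreal (indicator {0<..<1} t *
     (v * e * l powr e * t powr (e - 1) * (1 - t) powr (- e - 1))))"

definition model_radius :: "real \<Rightarrow> real \<Rightarrow> real \<Rightarrow> real" where
  "model_radius s l t = (l * t / (1 - t)) powr (1 / s)"

text \<open>The radial integrand of $G(l)$.\<close>

definition profile :: "real \<Rightarrow> real \<Rightarrow> real \<Rightarrow> real \<Rightarrow> real \<Rightarrow> real" where
  "profile q s N l r = r powr (- q) * (l + r powr s) powr (1 - N)"

lemma space_model_measure [simp]: "space (model_measure v e l) = UNIV"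
  by (simp add: model_measure_def)

lemma sets_model_measure [measurable_cong, simp]: "sets (model_measure v e l) = sets borel"
  by (simp add: model_measure_def)

lemma measurable_model_radius [measurable]: "model_radius s l \<in> borel_measurable borel"
  by (simp add: model_radius_def[abs_def])

lemma measurable_profile [measurable]: "profile q s N l \<in> borel_measurable borel"
  by (simp add: profile_def[abs_def])

lemma sigma_finite_model_measure: "sigma_finite_measure (model_measure v e l)"
  unfolding model_measure_def
  by (subst sigma_finite_measure.sigma_finite_iff_density_finite[OF sigma_finite_lborel]) auto

lemma AE_model_radius_pos:
  assumes "l > 0"
  shows "AE t in model_measure v e l. model_radius s l t > 0"
  unfolding model_measure_def
  by (subst AE_density) (use assms in \<open>auto simp: model_radius_def indicator_def\<close>)

lemma emeasure_model_radius_less: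
  assumes v: "v \<ge> 0" and m: "m > 0" and s: "s > 0" and l: "l > 0" and \<rho>: "\<rho> > 0"
  shows "emeasure (model_measure v (m / s) l) {t. model_radius s l t < \<rho>} = ennreal (v * \<rho> powr m)"
proof -
  define e where "e = m / s"
  have e: "e > 0" using m s by (simp add: e_def)
  define f where "f t = v * e * l powr e * t powr (e - 1) * (1 - t) powr (- e - 1)" for t
  define F where "F t = v * l powr e * (t / (1 - t)) powr e" for t
  define \<tau> where "\<tau> = \<rho> powr s / (l + \<rho> powr s)"
  have \<rho>s: "\<rho> powr s > 0" using \<rho> by simp
  have \<tau>: "0 < \<tau>" "\<tau> < 1" using \<rho>s l by (auto simp: \<tau>_def field_simps add_pos_pos)
  \<comment> \<open>in the coordinate \<open>t\<close>, the ball of radius \<open>\<rho>\<close> is the interval below \<open>\<tau>\<close>\<close>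
  have less_iff: "model_radius s l t < \<rho> \<longleftrightarrow> t < \<tau>" if "0 < t" "t < 1" for t
  proof -
    have "model_radius s l t < \<rho> \<longleftrightarrow> (l * t / (1 - t)) powr (1 / s) < (\<rho> powr s) powr (1 / s)"
      using s \<rho> by (simp add: model_radius_def powr_powr)
    also have "\<dots> \<longleftrightarrow> l * t / (1 - t) < \<rho> powr s"
      using s l \<rho> that powr_less_mono2[of "1 / s" "l * t / (1 - t)" "\<rho> powr s"]
        powr_mono2[of "1 / s" "\<rho> powr s" "l * t / (1 - t)"] by (meson divide_nonneg_pos diff_gt_0_iff_gt less_imp_le linorder_not_less mult_pos_pos
            powr_ge_zero zero_less_divide_1_iff)
    also have "\<dots> \<longleftrightarrow> t < \<tau>"
      using that l \<rho>s by (simp add: \<tau>_def field_simps add_pos_pos)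
    finally show ?thesis .
  qed
  have int: "(f has_integral (F \<tau> - F 0)) {0..\<tau>}"
  proof (rule fundamental_theorem_of_calculus_interior)
    show "0 \<le> \<tau>" using \<tau> by simp
    show "continuous_on {0..\<tau>} F"
      unfolding F_def using \<tau> e by (intro continuous_intros continuous_on_powr') auto
    fix t assume t: "t \<in> {0<..<\<tau>}"
    then have t': "0 < t" "t < 1" using \<tau> by auto
    have d: "((\<lambda>t. t / (1 - t)) has_real_derivative (1 / (1 - t)\<^sup>2)) (at t)"
      using t' by (auto intro!: derivative_eq_intros simp: field_simps power2_eq_square)
    have "((\<lambda>t. (t / (1 - t)) powr e) has_real_derivative e * (t / (1 - t)) powr (e - 1) * (1 / (1 - t)\<^sup>2)) (at t)"
      using DERIV_powr[OF d _ DERIV_const[of e]] t' 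
      by (simp add: powr_diff field_simps)
    then have "(F has_real_derivative v * l powr e * (e * (t / (1 - t)) powr (e - 1) * (1 / (1 - t)\<^sup>2))) (at t)"
      unfolding F_def by (intro DERIV_cmult)
    moreover
    have "(t / (1 - t)) powr (e - 1) * (1 / (1 - t)\<^sup>2) = t powr (e - 1) * (1 - t) powr (- e - 1)"
    proof -
      have "- e - 1 = - (e - 1) - 2" by simp
      then have "(1 - t) powr (- e - 1) = (1 - t) powr (- (e - 1) - 2)" by (simp only:)
      also have "\<dots> = (1 - t) powr (- (e - 1)) / (1 - t)\<^sup>2"
        using t' by (subst powr_diff) simp
      finally show ?thesis
        using t' powr_minus_divide[of "1 - t" "e - 1"] by (simp add: powr_divide)
    qed
    then have "v * l powr e * (e * (t / (1 - t)) powr (e - 1) * (1 / (1 - t)\<^sup>2)) = f t"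
      by (simp only: f_def mult.assoc mult.left_commute[of e])
    ultimately show "(F has_vector_derivative f t) (at t)"
      by (simp only: has_real_derivative_iff_has_vector_derivative)
  qed
  have F: "F \<tau> - F 0 = v * \<rho> powr m"
  proof -
    have "\<tau> / (1 - \<tau>) = \<rho> powr s / l"
    proof -
      have ne: "l + \<rho> powr s \<noteq> 0" using l \<rho>s by linarith
      then have "1 - \<tau> = l / (l + \<rho> powr s)" by (simp add: \<tau>_def diff_divide_eq_iff)
      then show ?thesis using ne by (simp add: \<tau>_def)
    qed
    then have "l powr e * (\<tau> / (1 - \<tau>)) powr e = \<rho> powr m"
      using l \<rho> s by (simp add: powr_divide powr_powr e_def)
    then show ?thesis by (simp add: F_def mult.assoc)
  qed
  have "emeasure (model_measure v e l) {t. model_radius s l t < \<rho>} =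
     (\<integral>\<^sup>+t. ennreal (indicator {0<..<1} t * f t) * indicator {t. model_radius s l t < \<rho>} t \<partial>lborel)"
    unfolding model_measure_def f_def by (subst emeasure_density) auto
  also have "\<dots> = (\<integral>\<^sup>+t. ennreal (f t) * indicator {0..\<tau>} t \<partial>lborel)"
  proof (rule nn_integral_cong_AE)
    have "AE t in lborel. t \<noteq> 0" "AE t in lborel. t \<noteq> \<tau>" by (auto intro: AE_lborel_singleton)
    then show "AE t in lborel. ennreal (indicator {0<..<1} t * f t) * indicator {t. model_radius s l t < \<rho>} t =
         ennreal (f t) * indicator {0..\<tau>} t"
      by eventually_elim (use less_iff \<tau> in \<open>force simp: indicator_def\<close>)
  qed
  also have "\<dots> = ennreal (F \<tau> - F 0)"
    using v e by (intro nn_integral_has_integral_lebesgue'[OF _ int]) (auto simp: f_def)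
  finally show ?thesis by (simp add: F e_def)
qed

text \<open>In the coordinate \<open>t\<close> one has \<open>l + r powr s = l / (1 - t)\<close>, so the
  integrand becomes that of a Beta integral; the relation between the exponents makes its
  parameters \<open>N / 2\<close> and \<open>N / 2 - 1\<close>.\<close>

lemma nn_integral_profile_model:
  assumes v: "v \<ge> 0" and m: "m > 0" and s: "s > 0" and N: "N > 2" and q: "m - q = s * N / 2" and l: "l > 0"
  shows "(\<integral>\<^sup>+t. ennreal (profile q s N l (model_radius s l t)) \<partial>model_measure v (m / s) l) =
           ennreal (v * (m / s) * Beta (N / 2) (N / 2 - 1) * l powr (- (N / 2 - 1)))"
proof -
  define e where "e = m / s"
  have e: "e > 0" using m s by (simp add: e_def)
  have eq: "e - q / s = N / 2" using q s by (simp add: e_def field_simps)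
  have eq': "- q / s = N / 2 - e" using eq by (simp only: minus_divide_left[symmetric])
  define f where "f t = v * e * l powr e * t powr (e - 1) * (1 - t) powr (- e - 1)" for t
  define c where "c = v * e * l powr (- (N / 2 - 1))"
  have key: "f t * profile q s N l (model_radius s l t) = c * (t powr (N / 2 - 1) * (1 - t) powr (N / 2 - 1 - 1))"
    if t: "0 < t" "t < 1" for t
  proof -
    have p: "profile q s N l (model_radius s l t) = (l * t / (1 - t)) powr (- q / s) * (l / (1 - t)) powr (1 - N)"
    proof -
      have "l + l * t / (1 - t) = l / (1 - t)" using t by (simp add: field_simps)
      then show ?thesis using t l s by (simp add: profile_def model_radius_def powr_powr)
    qed
    have "f t * profile q s N l (model_radius s l t) = v * e *
      (l powr e * l powr (- q / s) * l powr (1 - N)) * (t powr (e - 1) * t powr (- q / s)) *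
      ((1 - t) powr (- e - 1) * (1 - t) powr (q / s) * (1 - t) powr (N - 1))"
      unfolding p f_def using t l
      by (simp add: powr_divide powr_mult powr_minus_divide) (simp add: powr_diff field_simps)
    also have "l powr e * l powr (- q / s) * l powr (1 - N) = l powr (- (N / 2 - 1))"
    proof -
      have "e + - q / s + (1 - N) = - (N / 2 - 1)" using eq' by simp
      then show ?thesis by (simp only: powr_add[symmetric])
    qed
    also have "t powr (e - 1) * t powr (- q / s) = t powr (N / 2 - 1)"
    proof -
      have "e - 1 + - q / s = N / 2 - 1" unfolding eq[symmetric] by simp
      then show ?thesis by (simp only: powr_add[symmetric])
    qed
    also have "(1 - t) powr (- e - 1) * (1 - t) powr (q / s) * (1 - t) powr (N - 1) = (1 - t) powr (N / 2 - 1 - 1)"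
    proof -
      have "- e - 1 + q / s + (N - 1) = N / 2 - 1 - 1" using eq by (simp add: algebra_simps)
      then show ?thesis by (simp only: powr_add[symmetric])
    qed
    finally show ?thesis by (simp add: c_def)
  qed
  have "(\<integral>\<^sup>+t. ennreal (profile q s N l (model_radius s l t)) \<partial>model_measure v e l) =
     (\<integral>\<^sup>+t. ennreal (indicator {0<..<1} t * f t) * ennreal (profile q s N l (model_radius s l t)) \<partial>lborel)"
    unfolding model_measure_def f_def by (subst nn_integral_density) auto
  also have "\<dots> = (\<integral>\<^sup>+t. ennreal (c * (t powr (N / 2 - 1) * (1 - t) powr (N / 2 - 1 - 1))) * indicator {0..1} t \<partial>lborel)"
  proof (rule nn_integral_cong_AE)
    have "AE t in lborel. t \<noteq> 0" "AE t in lborel. t \<noteq> (1::real)" by (auto intro: AE_lborel_singleton)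
    then show "AE t in lborel. ennreal (indicator {0<..<1} t * f t) * ennreal (profile q s N l (model_radius s l t)) =
         ennreal (c * (t powr (N / 2 - 1) * (1 - t) powr (N / 2 - 1 - 1))) * indicator {0..1} t"
    proof eventually_elim
      case (elim t)
      show ?case
      proof (cases "0 < t \<and> t < 1")
        case True
        have "f t \<ge> 0" using v e by (simp add: f_def)
        then show ?thesis using True by (simp add: key flip: ennreal_mult')
      qed (use elim in auto)
    qed
  qed
  also have "\<dots> = ennreal (c * Beta (N / 2) (N / 2 - 1))"
    using N v e by (intro nn_integral_has_integral_lebesgue' has_integral_mult_right has_integral_Beta_real)
      (auto simp: c_def)
  finally show ?thesis by (simp add: e_def c_def mult_ac)
qed

lemma profile_nonneg: "profile q s N l r \<ge> 0"
  by (simp add: profile_def)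

lemma profile_antimono:
  assumes "q \<ge> 0" "s > 0" "N \<ge> 1" "l > 0" "0 < r" "r \<le> r'"
  shows "profile q s N l r' \<le> profile q s N l r"
  unfolding profile_def using assms
  by (intro mult_mono powr_mono2' add_left_mono powr_mono2 add_pos_nonneg) auto

lemma continuous_on_profile:
  assumes "l > 0"
  shows "continuous_on {0<..} (profile q s N l)"
proof -
  have "l + r powr s \<noteq> 0" for r using assms powr_ge_zero[of r s] by linarith
  then show ?thesis unfolding profile_def[abs_def] by (intro continuous_intros) auto
qed

lemma profile_decay:
  assumes "q \<ge> 0" "s > 0" "N > 1" "l > 0" "t > 0"
  shows "\<exists>R>0. profile q s N l R \<le> t"
proof -
  have f1: "filterlim (\<lambda>r::real. r powr s) at_top at_top"
    using assms by real_asymp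
  have f2: "filterlim (\<lambda>r::real. l + r powr s) at_top at_top"
    by (rule filterlim_tendsto_add_at_top[OF tendsto_const f1])
  have "((\<lambda>r. (l + r powr s) powr (1 - N)) \<longlongrightarrow> 0) at_top"
    using assms by (intro tendsto_neg_powr f2) auto
  then have "eventually (\<lambda>r. (l + r powr s) powr (1 - N) < t) at_top"
    using assms by (intro order_tendstoD)
  then have "eventually (\<lambda>r. (l + r powr s) powr (1 - N) < t \<and> r \<ge> 1) at_top"
    using eventually_ge_at_top[of 1] by eventually_elim auto
  then obtain R where R: "(l + R powr s) powr (1 - N) < t" "R \<ge> 1"
    using eventually_happens by force
  have "R powr (- q) \<le> 1" using R assms by (simp add: powr_minus ge_one_powr_ge_zero inverse_le_1_iff)
  then have "profile q s N l R \<le> 1 * (l + R powr s) powr (1 - N)"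
    unfolding profile_def by (intro mult_right_mono) auto
  then show ?thesis using R by (intro exI[of _ R]) auto
qed

lemma right_lower_semicontinuousI2:
  fixes f :: "real \<Rightarrow> real"
  assumes "continuous_on {b<..<c} f" "b < r" "r < c" "t < f r"
  shows "\<exists>r'>r. r' < c \<and> t < f r'"
proof -
  have "isCont f r"
    using assms by (intro continuous_on_interior[of "{b<..<c}"]) auto
  then have "(f \<longlongrightarrow> f r) (at_right r)"
    by (simp add: isCont_def filterlim_at_split)
  then have "eventually (\<lambda>r'. t < f r') (at_right r)"
    using assms(4) by (rule order_tendstoD)
  moreover have "eventually (\<lambda>r'. r' \<in> {r<..<c}) (at_right r)"
    using assms(3) by (rule eventually_at_right_real)
  ultimately have "eventually (\<lambda>r'. r < r' \<and> r' < c \<and> t < f r') (at_right r)"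
    by eventually_elim auto
  then show ?thesis using eventually_happens[of _ "at_right r"] by auto
qed

lemma right_lower_semicontinuousI:
  fixes f :: "real \<Rightarrow> real"
  assumes "b < r" "t < f r" "continuous_on {b<..} f"
  shows "\<exists>r'>r. t < f r'"
proof -
  have "continuous_on {b<..<r + 1} f"
    by (rule continuous_on_subset[OF assms(3)]) auto
  from right_lower_semicontinuousI2[OF this assms(1) _ assms(2)] show ?thesis by auto
qed

section \<open>Asymptotics of the bubble integral\<close>

lemma nn_integral_profile_le:
  assumes M: "sigma_finite_measure M" and [measurable]: "d \<in> borel_measurable M"
    and d: "AE x in M. d x > 0"
    and par: "v \<ge> 0" "m > 0" "s > 0" "N > 2" "q \<ge> 0" "m - q = s * N / 2" and l: "l > 0"
    and c: "c \<ge> 0"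
    and vol: "\<And>\<rho>. \<rho> > 0 \<Longrightarrow> emeasure M {x \<in> space M. d x < \<rho>} \<le> ennreal (c * (v * \<rho> powr m))"
  shows "(\<integral>\<^sup>+x. ennreal (profile q s N l (d x)) \<partial>M)
           \<le> ennreal (c * (v * (m / s) * Beta (N / 2) (N / 2 - 1) * l powr (- (N / 2 - 1))))"
proof -
  have "(\<integral>\<^sup>+x. ennreal (profile q s N l (d x)) \<partial>M)
      \<le> ennreal c * (\<integral>\<^sup>+t. ennreal (profile q s N l (model_radius s l t)) \<partial>model_measure v (m / s) l)"
  proof (rule radial_integral_mono[OF M sigma_finite_model_measure, where \<phi> = "profile q s N l" and d = d and d' = "model_radius s l"])
    fix r t :: real assume "0 < r" "t < profile q s N l r"
    then show "\<exists>r'>r. t < profile q s N l r'"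
      using continuous_on_profile[OF l] by (rule right_lower_semicontinuousI)
  next
    fix \<rho> :: real assume \<rho>: "\<rho> > 0"
    show "emeasure M {x \<in> space M. d x < \<rho>} \<le>
        ennreal c * emeasure (model_measure v (m / s) l) {x \<in> space (model_measure v (m / s) l). model_radius s l x < \<rho>}"
      using vol[OF \<rho>] c \<rho> par l by (simp add: emeasure_model_radius_less ennreal_mult)
  qed (use par l d in \<open>auto intro: profile_nonneg profile_antimono profile_decay AE_model_radius_pos\<close>)
  also have "\<dots> = ennreal (c * (v * (m / s) * Beta (N / 2) (N / 2 - 1) * l powr (- (N / 2 - 1))))"
    by (simp only: nn_integral_profile_model[OF par(1-4,6) l] ennreal_mult'[OF c])
  finally show ?thesis .
qed

text \<open>As \<open>l\<close> tends to 0 the bubble concentrates at the centre, so volumes of balls of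
  radius at most \<open>r\<^sub>0\<close> suffice: on the model, the part of the integral outside radius
  \<open>r\<^sub>0\<close> stays bounded, being at most a constant times the integral of the profile with
  parameter 1, whereas the whole integral blows up like \<open>l powr (- (N / 2 - 1))\<close>.\<close>

lemma nn_integral_profile_ge:
  assumes M: "sigma_finite_measure M" and [measurable]: "d \<in> borel_measurable M"
    and d: "AE x in M. d x > 0"
    and par: "v \<ge> 0" "m > 0" "s > 0" "N > 2" "q \<ge> 0" "m - q = s * N / 2" and l: "0 < l"
    and c: "c > 0" and r\<^sub>0: "r\<^sub>0 > 0"
    and vol: "\<And>\<rho>. 0 < \<rho> \<Longrightarrow> \<rho> \<le> r\<^sub>0 \<Longrightarrow> ennreal (c * (v * \<rho> powr m)) \<le> emeasure M {x \<in> space M. d x < \<rho>}"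
  defines "\<Gamma> \<equiv> v * (m / s) * Beta (N / 2) (N / 2 - 1)"
  shows "ennreal (\<Gamma> * l powr (- (N / 2 - 1))) \<le>
           ennreal (1 / c) * (\<integral>\<^sup>+x. ennreal (profile q s N l (d x)) \<partial>M) +
           ennreal ((1 + r\<^sub>0 powr (- s)) powr (N - 1) * \<Gamma>)"
proof -
  let ?\<nu> = "model_measure v (m / s) l" and ?d = "model_radius s l"
  define \<phi> where "\<phi> r = (if r < r\<^sub>0 then profile q s N l r else 0)" for r
  define T where "T = (1 + r\<^sub>0 powr (- s)) powr (N - 1)"
  have [measurable]: "\<phi> \<in> borel_measurable borel" unfolding \<phi>_def by measurable
  have T: "profile q s N l r \<le> \<phi> r + T * profile q s N 1 r" if r: "r > 0" for r
  proof (cases "r < r\<^sub>0")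
    case True
    then show ?thesis by (simp add: \<phi>_def T_def profile_nonneg)
  next
    case False
    have "1 + r powr s \<le> (1 + r\<^sub>0 powr (- s)) * (l + r powr s)"
    proof -
      have "1 = r\<^sub>0 powr (- s) * r\<^sub>0 powr s" using r\<^sub>0 by (simp flip: powr_add)
      also have "\<dots> \<le> r\<^sub>0 powr (- s) * r powr s"
        using False r\<^sub>0 par by (intro mult_left_mono powr_mono2) auto
      finally show ?thesis using l by (simp add: algebra_simps add_increasing)
    qed
    then have "((1 + r\<^sub>0 powr (- s)) * (l + r powr s)) powr (1 - N) \<le> (1 + r powr s) powr (1 - N)"
      using par by (intro powr_mono2') (auto intro: add_pos_nonneg)
    then have "(1 + r\<^sub>0 powr (- s)) powr (1 - N) * (l + r powr s) powr (1 - N) \<le> (1 + r powr s) powr (1 - N)"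
      using l by (simp add: powr_mult)
    then have "T * ((1 + r\<^sub>0 powr (- s)) powr (1 - N) * (l + r powr s) powr (1 - N)) \<le> T * (1 + r powr s) powr (1 - N)"
      by (intro mult_left_mono) (auto simp: T_def)
    moreover have "T * (1 + r\<^sub>0 powr (- s)) powr (1 - N) = 1"
      unfolding T_def powr_add[symmetric] using add_pos_nonneg[of 1 "r\<^sub>0 powr (- s)"] by simp
    ultimately have "(l + r powr s) powr (1 - N) \<le> T * (1 + r powr s) powr (1 - N)"
      by (simp flip: mult.assoc)
    from mult_left_mono[OF this, of "r powr (- q)"] False show ?thesis
      by (simp add: \<phi>_def profile_def mult.left_commute)
  qed
  have vol': "emeasure ?\<nu> {t \<in> space ?\<nu>. ?d t < \<rho>} = ennreal (v * \<rho> powr m)" if "\<rho> > 0" for \<rho>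
    using that par l by (simp add: emeasure_model_radius_less)
  have "ennreal (\<Gamma> * l powr (- (N / 2 - 1))) = (\<integral>\<^sup>+t. ennreal (profile q s N l (?d t)) \<partial>?\<nu>)"
    unfolding \<Gamma>_def using par l by (subst nn_integral_profile_model) auto
  also have "\<dots> \<le> (\<integral>\<^sup>+t. ennreal (\<phi> (?d t)) + ennreal T * ennreal (profile q s N 1 (?d t)) \<partial>?\<nu>)"
  proof (rule nn_integral_mono_AE, use AE_model_radius_pos[OF l, of s v "m / s"] in eventually_elim)
    case (elim t)
    from ennreal_leI[OF T[OF elim]] show ?case
      by (simp add: \<phi>_def T_def profile_nonneg ennreal_plus ennreal_mult)
  qed
  also have "\<dots> = (\<integral>\<^sup>+t. ennreal (\<phi> (?d t)) \<partial>?\<nu>) + ennreal T * (\<integral>\<^sup>+t. ennreal (profile q s N 1 (?d t)) \<partial>?\<nu>)"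
    by (simp add: nn_integral_add nn_integral_cmult)
  also have "\<dots> \<le> ennreal (1 / c) * (\<integral>\<^sup>+x. ennreal (profile q s N l (d x)) \<partial>M) + ennreal T * ennreal \<Gamma>"
  proof (intro add_mono mult_left_mono)
    have "(\<integral>\<^sup>+t. ennreal (\<phi> (?d t)) \<partial>?\<nu>) \<le> ennreal (1 / c) * (\<integral>\<^sup>+x. ennreal (\<phi> (d x)) \<partial>M)"
    proof (rule radial_integral_mono[OF sigma_finite_model_measure M, where \<phi> = \<phi> and d' = d and d = ?d])
      fix r t :: real assume rt: "0 < r" "0 < t" "t < \<phi> r"
      then have "r < r\<^sub>0" "t < profile q s N l r" by (auto simp: \<phi>_def split: if_splits)
      moreover have "continuous_on {0<..<r\<^sub>0} (profile q s N l)"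
        by (rule continuous_on_subset[OF continuous_on_profile[OF l]]) auto
      ultimately have "\<exists>r'>r. r' < r\<^sub>0 \<and> t < profile q s N l r'"
        using right_lower_semicontinuousI2 rt by blast
      then show "\<exists>r'>r. t < \<phi> r'" by (auto simp: \<phi>_def)
    next
      fix r r' :: real assume "0 < r" "r \<le> r'"
      then show "\<phi> r' \<le> \<phi> r"
        using profile_antimono[of q s N l r r'] par l by (auto simp: \<phi>_def profile_nonneg)
    next
      fix t :: real assume "0 < t"
      then show "\<exists>R>0. \<phi> R \<le> t" using r\<^sub>0 by (intro exI[of _ r\<^sub>0]) (auto simp: \<phi>_def)
    next
      fix \<rho> t :: real assume \<rho>: "\<rho> > 0" "0 < t" and lev: "\<And>r. 0 < r \<Longrightarrow> t < \<phi> r \<longleftrightarrow> r < \<rho>"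
      have "\<rho> \<le> r\<^sub>0" using lev[OF r\<^sub>0] \<rho> by (auto simp: \<phi>_def)
      have "ennreal (v * \<rho> powr m) = ennreal (1 / c) * ennreal (c * (v * \<rho> powr m))"
        using c par by (simp flip: ennreal_mult)
      also have "\<dots> \<le> ennreal (1 / c) * emeasure M {x \<in> space M. d x < \<rho>}"
        using vol[OF \<rho>(1) \<open>\<rho> \<le> r\<^sub>0\<close>] by (intro mult_left_mono) auto
      finally show "emeasure ?\<nu> {t \<in> space ?\<nu>. ?d t < \<rho>} \<le> ennreal (1 / c) * emeasure M {x \<in> space M. d x < \<rho>}"
        using vol'[OF \<rho>(1)] by simp
    qed (use d l in \<open>auto intro: AE_model_radius_pos simp: \<phi>_def profile_nonneg\<close>)
    also have "\<dots> \<le> ennreal (1 / c) * (\<integral>\<^sup>+x. ennreal (profile q s N l (d x)) \<partial>M)"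
      by (intro mult_left_mono nn_integral_mono) (auto simp: \<phi>_def profile_nonneg)
    finally show "(\<integral>\<^sup>+t. ennreal (\<phi> (?d t)) \<partial>?\<nu>) \<le> ennreal (1 / c) * (\<integral>\<^sup>+x. ennreal (profile q s N l (d x)) \<partial>M)" .
    have "(\<integral>\<^sup>+t. ennreal (profile q s N 1 (?d t)) \<partial>?\<nu>) \<le>
       ennreal (1 * (v * (m / s) * Beta (N / 2) (N / 2 - 1) * 1 powr (- (N / 2 - 1))))"
      by (intro nn_integral_profile_le sigma_finite_model_measure AE_model_radius_pos[OF l] par)
         (use vol' in auto)
    then show "(\<integral>\<^sup>+t. ennreal (profile q s N 1 (?d t)) \<partial>?\<nu>) \<le> ennreal \<Gamma>"
      by (simp add: \<Gamma>_def)
  qed auto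
  finally show ?thesis by (simp add: T_def ennreal_mult')
qed

text \<open>As \<open>l\<close> tends to infinity the bubble spreads out. Flattening the profile inside
  radius \<open>R\<^sub>0\<close> leaves a function whose superlevel sets are balls of radius at least
  \<open>R\<^sub>0\<close>. The part lost by the flattening is at most a multiple of
  \<open>l powr (1 - N)\<close>, which is of lower order because \<open>1 - N < - (N / 2 - 1)\<close>.\<close>

lemma nn_integral_profile_le_large:
  assumes M: "sigma_finite_measure M" and [measurable]: "d \<in> borel_measurable M"
    and d: "AE x in M. d x > 0"
    and par: "v \<ge> 0" "m > 0" "s > 0" "N > 2" "q \<ge> 0" "m - q = s * N / 2" and l: "0 < l"
    and c: "c \<ge> 0" and R\<^sub>0: "R\<^sub>0 > 0"
    and vol: "\<And>\<rho>. R\<^sub>0 \<le> \<rho> \<Longrightarrow> emeasure M {x \<in> space M. d x < \<rho>} \<le> ennreal (c * (v * \<rho> powr m))"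
  defines "\<Gamma> \<equiv> v * (m / s) * Beta (N / 2) (N / 2 - 1)"
  shows "(\<integral>\<^sup>+x. ennreal (profile q s N l (d x)) \<partial>M) \<le> ennreal (c * \<Gamma> * l powr (- (N / 2 - 1))) +
           ennreal ((1 + R\<^sub>0 powr s) powr (N - 1) * l powr (1 - N)) * (\<integral>\<^sup>+x. ennreal (profile q s N 1 (d x)) \<partial>M)"
proof -
  let ?\<nu> = "model_measure v (m / s) l" and ?d = "model_radius s l"
  define \<phi> where "\<phi> r = min (profile q s N l r) (profile q s N l R\<^sub>0)" for r
  define T where "T = (1 + R\<^sub>0 powr s) powr (N - 1) * l powr (1 - N)"
  have [measurable]: "\<phi> \<in> borel_measurable borel" unfolding \<phi>_def by measurable
  have T: "profile q s N l r \<le> \<phi> r + T * profile q s N 1 r" if r: "r > 0" for r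
  proof (cases "r \<le> R\<^sub>0")
    case False
    then have "\<phi> r = profile q s N l r"
      using profile_antimono[of q s N l R\<^sub>0 r] par l R\<^sub>0 by (simp add: \<phi>_def)
    then show ?thesis by (simp add: T_def profile_nonneg)
  next
    case True
    have p1: "1 + r powr s > 0" for r :: real by (intro add_pos_nonneg) auto
    have "(l + r powr s) powr (1 - N) \<le> l powr (1 - N)"
      using par l by (intro powr_mono2') auto
    also have "1 = ((1 + R\<^sub>0 powr s) powr (N - 1)) * (1 + R\<^sub>0 powr s) powr (1 - N)"
      using p1[of R\<^sub>0] by (simp flip: powr_add)
    then have "l powr (1 - N) = T * (1 + R\<^sub>0 powr s) powr (1 - N)"
      by (simp add: T_def mult_ac)
    also have "\<dots> \<le> T * (1 + r powr s) powr (1 - N)"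
      using True r par p1[of r] by (intro mult_left_mono powr_mono2' add_left_mono powr_mono2) (auto simp: T_def)
    finally have "r powr (- q) * (l + r powr s) powr (1 - N) \<le> r powr (- q) * (T * (1 + r powr s) powr (1 - N))"
      by (intro mult_left_mono) auto
    then have "profile q s N l r \<le> T * profile q s N 1 r" by (simp add: profile_def mult.left_commute)
    then show ?thesis by (simp add: \<phi>_def profile_nonneg add_increasing)
  qed
  have "(\<integral>\<^sup>+x. ennreal (profile q s N l (d x)) \<partial>M) \<le>
       (\<integral>\<^sup>+x. ennreal (\<phi> (d x)) + ennreal T * ennreal (profile q s N 1 (d x)) \<partial>M)"
  proof (rule nn_integral_mono_AE, use d in eventually_elim)
    case (elim x)
    from ennreal_leI[OF T[OF elim]] show ?case
      by (simp add: \<phi>_def T_def profile_nonneg ennreal_plus ennreal_mult)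
  qed
  also have "\<dots> = (\<integral>\<^sup>+x. ennreal (\<phi> (d x)) \<partial>M) + ennreal T * (\<integral>\<^sup>+x. ennreal (profile q s N 1 (d x)) \<partial>M)"
    by (simp add: nn_integral_add nn_integral_cmult)
  also have "(\<integral>\<^sup>+x. ennreal (\<phi> (d x)) \<partial>M) \<le> ennreal c * (\<integral>\<^sup>+t. ennreal (\<phi> (?d t)) \<partial>?\<nu>)"
  proof (rule radial_integral_mono[OF M sigma_finite_model_measure, where \<phi> = \<phi> and d = d and d' = ?d])
    fix r t :: real assume rt: "0 < r" "0 < t" "t < \<phi> r"
    have "continuous_on {0<..} \<phi>"
      unfolding \<phi>_def by (intro continuous_intros continuous_on_profile l)
    then show "\<exists>r'>r. t < \<phi> r'" using right_lower_semicontinuousI rt by blast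
  next
    fix r r' :: real assume "0 < r" "r \<le> r'"
    then show "\<phi> r' \<le> \<phi> r"
      using profile_antimono[of q s N l r r'] par l by (auto simp: \<phi>_def)
  next
    fix t :: real assume "0 < t"
    then obtain R where "R > 0" "profile q s N l R \<le> t" using profile_decay[of q s N l t] par l by auto
    then show "\<exists>R>0. \<phi> R \<le> t" by (auto simp: \<phi>_def)
  next
    fix \<rho> t :: real assume \<rho>: "\<rho> > 0" "0 < t" and lev: "\<And>r. 0 < r \<Longrightarrow> t < \<phi> r \<longleftrightarrow> r < \<rho>"
    have "R\<^sub>0 \<le> \<rho>"
    proof (rule ccontr)
      assume "\<not> R\<^sub>0 \<le> \<rho>"
      then have "\<not> t < \<phi> R\<^sub>0" "\<phi> (\<rho> / 2) = \<phi> R\<^sub>0"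
        using lev[OF R\<^sub>0] profile_antimono[of q s N l "\<rho> / 2" R\<^sub>0] par l \<rho> by (auto simp: \<phi>_def)
      then show False using lev[of "\<rho> / 2"] \<rho> by simp
    qed
    then show "emeasure M {x \<in> space M. d x < \<rho>} \<le> ennreal c * emeasure ?\<nu> {t \<in> space ?\<nu>. ?d t < \<rho>}"
      using vol[of \<rho>] \<rho> par l c by (simp add: emeasure_model_radius_less ennreal_mult)
  qed (use d l in \<open>auto intro: AE_model_radius_pos simp: \<phi>_def profile_nonneg\<close>)
  also have "\<dots> \<le> ennreal c * (\<integral>\<^sup>+t. ennreal (profile q s N l (?d t)) \<partial>?\<nu>)"
    by (intro mult_left_mono nn_integral_mono) (auto simp: \<phi>_def intro: ennreal_leI)
  also have "(\<integral>\<^sup>+t. ennreal (profile q s N l (?d t)) \<partial>?\<nu>) = ennreal (\<Gamma> * l powr (- (N / 2 - 1)))"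
    unfolding \<Gamma>_def using par l by (subst nn_integral_profile_model) auto
  also have "ennreal c * \<dots> = ennreal (c * \<Gamma> * l powr (- (N / 2 - 1)))"
    using c by (simp add: ennreal_mult' mult.assoc)
  finally show ?thesis by (simp add: T_def add_right_mono)
qed

section \<open>Volume growth at infinity\<close>

text \<open>Here the metric space enters only through the volumes of the balls \<open>d x < \<rho>\<close> and
  the inequality for the bubbles, stated as \<open>sobolev\<close>: the gradient integral controls
  $J$. Comparison gives $G(l) \ge \kappa \Gamma l^{-k}$ for all \<open>l\<close>. If all large balls had
  volume at most $c v R^m$ with $c < \kappa$, then also
  $G(l) \le c \Gamma l^{-k} + B l^{1-N}$, which fails for large \<open>l\<close>.\<close>

lemma volume_growth_at_infinity:
  fixes d :: "'a \<Rightarrow> real"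
  assumes M: "sigma_finite_measure M" and [measurable]: "d \<in> borel_measurable M"
    and d: "AE x in M. d x > 0"
    and par: "v > 0" "m > 0" "s > 0" "N > 2" "q \<ge> 0" "m - q = s * N / 2"
    and C\<^sub>0: "C\<^sub>0 \<ge> 0" and upper: "\<And>\<rho>. \<rho> > 0 \<Longrightarrow> emeasure M {x \<in> space M. d x < \<rho>} \<le> ennreal (C\<^sub>0 * (v * \<rho> powr m))"
    and lower: "\<And>c. 0 < c \<Longrightarrow> c < 1 \<Longrightarrow> \<exists>r\<^sub>0>0. \<forall>\<rho>. 0 < \<rho> \<longrightarrow> \<rho> \<le> r\<^sub>0 \<longrightarrow>
       ennreal (c * (v * \<rho> powr m)) \<le> emeasure M {x \<in> space M. d x < \<rho>}"
    and A: "A > 0"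
    and sobolev: "\<And>l B. l > 0 \<Longrightarrow> B \<ge> 0 \<Longrightarrow>
        (\<integral>\<^sup>+x. ennreal (d x powr (s - q) * (l + d x powr s) powr (- N)) \<partial>M) \<le> ennreal B \<Longrightarrow>
        (\<integral>\<^sup>+x. ennreal (d x powr (- q) * (l + d x powr s) powr (- N)) \<partial>M) \<le> ennreal ((A * B) powr (1 / (1 - 2 / N)))"
    and \<kappa>: "0 < \<kappa>" "\<kappa> < 1"
    and crit: "((N / 2 - 1) * (\<kappa> * (v * (m / s) * Beta (N / 2) (N / 2 - 1))) / (N - 1)) powr (1 - 2 / N) =
        A * (\<kappa> * (v * (m / s) * Beta (N / 2) (N / 2 - 1)) - (N / 2 - 1) * (\<kappa> * (v * (m / s) * Beta (N / 2) (N / 2 - 1))) / (N - 1))"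
    and c: "0 \<le> c" "c < \<kappa>" and R\<^sub>0: "R\<^sub>0 > 0"
  shows "\<exists>R\<ge>R\<^sub>0. emeasure M {x \<in> space M. d x < R} > ennreal (c * (v * R powr m))"
proof (rule ccontr)
  assume "\<not> ?thesis"
  then have small: "\<And>R. R\<^sub>0 \<le> R \<Longrightarrow> emeasure M {x \<in> space M. d x < R} \<le> ennreal (c * (v * R powr m))"
    by (auto simp: not_less)
  define \<Gamma> where "\<Gamma> = v * (m / s) * Beta (N / 2) (N / 2 - 1)"
  define k where "k = N / 2 - 1"
  have k: "k > 0" using par by (simp add: k_def)
  have par': "v \<ge> 0" "m > 0" "s > 0" "N > 2" "q \<ge> 0" "m - q = s * N / 2" using par by auto
  have \<Gamma>: "\<Gamma> > 0" using par by (simp add: \<Gamma>_def Beta_def Gamma_real_pos)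
  define G where "G l = (\<integral>x. profile q s N l (d x) \<partial>M)" for l
  define J where "J l = (\<integral>x. d x powr (- q) * (l + d x powr s) powr (- N) \<partial>M)" for l
  have upperG: "(\<integral>\<^sup>+x. ennreal (profile q s N l (d x)) \<partial>M) \<le> ennreal (C\<^sub>0 * (\<Gamma> * l powr (- k)))" if "l > 0" for l
    unfolding \<Gamma>_def k_def by (intro nn_integral_profile_le[OF M _ d par' that C\<^sub>0 upper]) auto
  have intG: "integrable M (\<lambda>x. profile q s N l (d x))" if "l > 0" for l
    using upperG[OF that]
    by (intro integrableI_nonneg) (auto simp: profile_nonneg less_top[symmetric] top_unique)
  have G: "(\<integral>\<^sup>+x. ennreal (profile q s N l (d x)) \<partial>M) = ennreal (G l)" if "l > 0" for l
    unfolding G_def by (intro nn_integral_eq_integral intG that AE_I2 profile_nonneg)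
  have G0: "G l \<ge> 0" for l unfolding G_def by (intro integral_nonneg_AE AE_I2 profile_nonneg)
  have J0: "J l \<ge> 0" for l unfolding J_def by (intro integral_nonneg_AE AE_I2) auto
  have pos: "l + d x powr s > 0" if "l > 0" for l x using that by (intro add_pos_nonneg) auto
  have split: "d x powr (s - q) * (l + d x powr s) powr (- N) =
      profile q s N l (d x) - l * (d x powr (- q) * (l + d x powr s) powr (- N))" if "l > 0" "d x > 0" for l x
  proof -
    have "d x powr (s - q) = d x powr s * d x powr (- q)" by (simp flip: powr_add)
    moreover have "(l + d x powr s) powr (1 - N) = (l + d x powr s) * (l + d x powr s) powr (- N)"
      using pos[OF that(1), of x] by (simp add: powr_diff powr_minus field_simps)
    ultimately show ?thesis by (simp add: profile_def algebra_simps)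
  qed
  have intJ: "integrable M (\<lambda>x. d x powr (- q) * (l + d x powr s) powr (- N))" if l: "l > 0" for l
  proof (rule Bochner_Integration.integrable_bound[OF integrable_divide[OF intG[OF l], of l]])
    show "AE x in M. norm (d x powr (- q) * (l + d x powr s) powr (- N)) \<le> norm (profile q s N l (d x) / l)"
    proof (use d in eventually_elim)
      case (elim x)
      have "l * (d x powr (- q) * (l + d x powr s) powr (- N)) \<le> profile q s N l (d x)"
        using split[OF l elim] mult_nonneg_nonneg[OF powr_ge_zero[of "d x" "s - q"] powr_ge_zero[of "l + d x powr s" "- N"]]
        by linarith
      then show ?case using l by (simp add: profile_nonneg field_simps)
    qed
  qed measurable
  have ode: "J l powr (1 - 2 / N) \<le> A * (G l - l * J l)" if l: "l > 0" for l
  proof -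
    have "(\<integral>\<^sup>+x. ennreal (d x powr (s - q) * (l + d x powr s) powr (- N)) \<partial>M) =
        (\<integral>\<^sup>+x. ennreal (profile q s N l (d x) - l * (d x powr (- q) * (l + d x powr s) powr (- N))) \<partial>M)"
      by (rule nn_integral_cong_AE, use d in eventually_elim) (simp add: split[OF l])
    also have "\<dots> = ennreal (\<integral>x. profile q s N l (d x) - l * (d x powr (- q) * (l + d x powr s) powr (- N)) \<partial>M)"
    proof (rule nn_integral_eq_integral)
      show "AE x in M. 0 \<le> profile q s N l (d x) - l * (d x powr (- q) * (l + d x powr s) powr (- N))"
        by (use d in eventually_elim) (simp flip: split[OF l])
    qed (use intG[OF l] intJ[OF l] in simp)
    also have "(\<integral>x. profile q s N l (d x) - l * (d x powr (- q) * (l + d x powr s) powr (- N)) \<partial>M) = G l - l * J l"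
      unfolding G_def J_def using intG[OF l] intJ[OF l] by simp
    finally have I: "(\<integral>\<^sup>+x. ennreal (d x powr (s - q) * (l + d x powr s) powr (- N)) \<partial>M) = ennreal (G l - l * J l)" .
    have I0: "0 \<le> G l - l * J l"
    proof -
      have "0 \<le> (\<integral>x. profile q s N l (d x) - l * (d x powr (- q) * (l + d x powr s) powr (- N)) \<partial>M)"
        by (rule integral_nonneg_AE, use d in eventually_elim) (simp flip: split[OF l])
      also have "\<dots> = G l - l * J l"
        unfolding G_def J_def using intG[OF l] intJ[OF l] by simp
      finally show ?thesis .
    qed
    have "ennreal (J l) = (\<integral>\<^sup>+x. ennreal (d x powr (- q) * (l + d x powr s) powr (- N)) \<partial>M)"
      unfolding J_def by (intro nn_integral_eq_integral[symmetric] intJ[OF l]) auto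
    also have "\<dots> \<le> ennreal ((A * (G l - l * J l)) powr (1 / (1 - 2 / N)))"
      using sobolev[OF l I0] I by simp
    finally have "J l \<le> (A * (G l - l * J l)) powr (1 / (1 - 2 / N))" by (simp add: ennreal_le_iff)
    moreover have e: "1 - 2 / N > 0" using par by simp
    ultimately have "J l powr (1 - 2 / N) \<le> ((A * (G l - l * J l)) powr (1 / (1 - 2 / N))) powr (1 - 2 / N)"
      using J0 by (intro powr_mono2) auto
    also have "\<dots> = A * (G l - l * J l)" using e A I0 par by (simp add: powr_powr)
    finally show ?thesis .
  qed
  have deriv: "(G has_real_derivative - (N - 1) * J l) (at l)" if l: "l > 0" for l
    unfolding G_def[abs_def] J_def profile_def
    by (rule power_integral_has_derivative) (use l par intG in \<open>auto simp: profile_def\<close>)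
  have near0: "eventually (\<lambda>l. G l \<ge> (\<kappa> + 1) / 2 * \<Gamma> * l powr (- k)) (at_right 0)"
  proof -
    \<comment> \<open>strictly between the initial ratio \<open>(\<kappa> + 1) / 2\<close> and 1, to absorb the bounded error term \<open>T\<close>\<close>
    define c1 where "c1 = (\<kappa> + 3) / 4"
    have c1: "0 < c1" "c1 < 1" "c1 > (\<kappa> + 1) / 2" using \<kappa> by (auto simp: c1_def)
    obtain r\<^sub>0 where r0: "r\<^sub>0 > 0" "\<And>\<rho>. 0 < \<rho> \<Longrightarrow> \<rho> \<le> r\<^sub>0 \<Longrightarrow>
       ennreal (c1 * (v * \<rho> powr m)) \<le> emeasure M {x \<in> space M. d x < \<rho>}"
      using lower[OF c1(1,2)] by blast
    define T where "T = (1 + r\<^sub>0 powr (- s)) powr (N - 1) * \<Gamma>"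
    have T0: "T \<ge> 0" using \<Gamma> by (simp add: T_def)
    have ge: "c1 * (\<Gamma> * l powr (- k) - T) \<le> G l" if l: "l > 0" for l
    proof -
      have "ennreal (\<Gamma> * l powr (- k)) \<le> ennreal (1 / c1) * (\<integral>\<^sup>+x. ennreal (profile q s N l (d x)) \<partial>M) + ennreal T"
        unfolding \<Gamma>_def k_def T_def by (rule nn_integral_profile_ge[OF M _ d par' l c1(1) r0]) auto
      also have "\<dots> = ennreal (1 / c1 * G l + T)"
        using G[OF l] G0[of l] c1 T0 by (simp add: ennreal_plus ennreal_mult'' flip: ennreal_mult)
      finally have "\<Gamma> * l powr (- k) \<le> 1 / c1 * G l + T"
        using G0[of l] c1 T0 by (subst (asm) ennreal_le_iff) auto
      then show ?thesis using c1 by (simp add: field_simps)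
    qed
    have "filterlim (\<lambda>l::real. l powr (- k)) at_top (at_right 0)"
      using k by real_asymp
    then have "eventually (\<lambda>l. l powr (- k) \<ge> c1 * T / ((c1 - (\<kappa> + 1) / 2) * \<Gamma>)) (at_right 0)"
      by (simp add: filterlim_at_top)
    moreover have "eventually (\<lambda>l::real. l > 0) (at_right 0)"
      by (rule eventually_at_right_less)
    ultimately show ?thesis
    proof eventually_elim
      case (elim l)
      have "c1 * T \<le> (c1 - (\<kappa> + 1) / 2) * \<Gamma> * l powr (- k)"
        using elim(1) c1 \<Gamma> by (subst (asm) pos_divide_le_eq) (auto simp: mult.commute)
      also have "\<dots> = c1 * (\<Gamma> * l powr (- k)) - (\<kappa> + 1) / 2 * \<Gamma> * l powr (- k)" by (simp add: algebra_simps)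
      finally have "(\<kappa> + 1) / 2 * \<Gamma> * l powr (- k) \<le> c1 * (\<Gamma> * l powr (- k) - T)"
        by (simp add: right_diff_distrib)
      then show ?case using ge[of l] elim by simp
    qed
  qed
  have lowerG: "G l \<ge> \<kappa> * \<Gamma> * l powr (- k)" if l: "l > 0" for l
  proof (rule ode_comparison[OF A par(4) k_def])
    show "0 < \<kappa> * \<Gamma>" "\<kappa> * \<Gamma> < (\<kappa> + 1) / 2 * \<Gamma>" using \<kappa> \<Gamma> by auto
    show "(k * (\<kappa> * \<Gamma>) / (N - 1)) powr (1 - 2 / N) = A * (\<kappa> * \<Gamma> - k * (\<kappa> * \<Gamma>) / (N - 1))"
      unfolding k_def \<Gamma>_def by (rule crit)
  qed (use deriv ode near0 l in auto)
  define B where "B = (1 + R\<^sub>0 powr s) powr (N - 1) * G 1"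
  have B0: "B \<ge> 0" using G0[of 1] by (simp add: B_def)
  have up: "G l \<le> c * \<Gamma> * l powr (- k) + B * l powr (1 - N)" if l: "l > 0" for l
  proof -
    have "ennreal (G l) \<le> ennreal (c * \<Gamma> * l powr (- k)) +
        ennreal ((1 + R\<^sub>0 powr s) powr (N - 1) * l powr (1 - N)) * (\<integral>\<^sup>+x. ennreal (profile q s N 1 (d x)) \<partial>M)"
      unfolding G[OF l, symmetric] \<Gamma>_def k_def
      by (rule nn_integral_profile_le_large[OF M _ d par' l c(1) R\<^sub>0 small]) auto
    also have "\<dots> = ennreal (c * \<Gamma> * l powr (- k) + B * l powr (1 - N))"
      using G[of 1] G0[of 1] c \<Gamma> by (simp add: B_def mult_ac flip: ennreal_mult ennreal_plus)
    finally show ?thesis using c \<Gamma> B0 by (subst (asm) ennreal_le_iff) auto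
  qed
  have "eventually (\<lambda>l. (\<kappa> - c) * \<Gamma> \<le> B * l powr (1 - N + k)) at_top"
    using eventually_gt_at_top[of 0]
  proof eventually_elim
    case (elim l)
    have "(\<kappa> - c) * \<Gamma> * l powr (- k) \<le> B * l powr (1 - N)"
      using lowerG[OF elim] up[OF elim] by (simp add: algebra_simps)
    then have "(\<kappa> - c) * \<Gamma> * l powr (- k) * l powr k \<le> B * l powr (1 - N) * l powr k"
      by (intro mult_right_mono) auto
    then show ?case using elim by (simp add: mult.assoc flip: powr_add)
  qed
  moreover have "((\<lambda>l. B * l powr (1 - N + k)) \<longlongrightarrow> B * 0) at_top"
    using par by (intro tendsto_mult tendsto_const tendsto_neg_powr filterlim_ident) (auto simp: k_def)
  ultimately have "(\<kappa> - c) * \<Gamma> \<le> B * 0"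
    by (intro tendsto_lowerbound[of _ _ at_top]) auto
  moreover have "(\<kappa> - c) * \<Gamma> > 0" using c \<Gamma> by simp
  ultimately show False by simp
qed

section \<open>Bubbles as test functions\<close>

text \<open>Since the distance to \<open>x\<^sub>0\<close> is 1-Lipschitz, difference quotients of a radial
  function are bounded by those of its profile.\<close>

lemma local_lip_radial_le:
  fixes h :: "real \<Rightarrow> real" and x\<^sub>0 x :: "'a::metric_space"
  assumes m: "m \<ge> 0"
    and h: "\<And>e. e > 0 \<Longrightarrow> eventually (\<lambda>r. \<bar>h r - h (dist x\<^sub>0 x)\<bar> \<le> (m + e) * \<bar>r - dist x\<^sub>0 x\<bar>) (nhds (dist x\<^sub>0 x))"
  shows "local_lip (\<lambda>y. h (dist x\<^sub>0 y)) x \<le> ennreal m"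
proof -
  have le: "local_lip (\<lambda>y. h (dist x\<^sub>0 y)) x \<le> ennreal (m + e)" if e: "e > 0" for e
    unfolding local_lip_def
  proof (rule Limsup_bounded)
    have "((\<lambda>y. dist x\<^sub>0 y) \<longlongrightarrow> dist x\<^sub>0 x) (at x)" by (intro tendsto_intros)
    then have "eventually (\<lambda>y. \<bar>h (dist x\<^sub>0 y) - h (dist x\<^sub>0 x)\<bar> \<le> (m + e) * \<bar>dist x\<^sub>0 y - dist x\<^sub>0 x\<bar>) (at x)"
      using h[OF e] by (rule eventually_compose_filterlim[rotated])
    moreover have "eventually (\<lambda>y. y \<noteq> x) (at x)" by (simp add: eventually_at_filter)
    ultimately show "eventually (\<lambda>y. ennreal (\<bar>h (dist x\<^sub>0 y) - h (dist x\<^sub>0 x)\<bar> / dist x y) \<le> ennreal (m + e)) (at x)"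
    proof eventually_elim
      case (elim y)
      have "\<bar>dist x\<^sub>0 y - dist x\<^sub>0 x\<bar> \<le> dist x y"
        using dist_triangle[of x\<^sub>0 y x] dist_triangle[of x\<^sub>0 x y] by (simp add: dist_commute abs_le_iff)
      then have "\<bar>h (dist x\<^sub>0 y) - h (dist x\<^sub>0 x)\<bar> \<le> (m + e) * dist x y"
        using elim(1) m e by (meson add_nonneg_pos less_imp_le mult_left_mono order_trans)
      then show ?case using elim(2) by (intro ennreal_leI) (simp add: divide_le_eq)
    qed
  qed
  show ?thesis
  proof (rule ennreal_le_epsilon)
    fix e :: real assume "e > 0"
    then show "local_lip (\<lambda>y. h (dist x\<^sub>0 y)) x \<le> ennreal m + ennreal e"
      using le[of e] m by (simp add: ennreal_plus)
  qed
qed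

lemma CKN_inequality_bound:
  assumes CKN: "CKN_inequality M x\<^sub>0 a p C" and u: "u \<in> Lip0" and p: "p > 0" and C: "C \<ge> 0"
    and B: "(\<integral>\<^sup>+x. (local_lip u x)\<^sup>2 \<partial>M) \<le> ennreal B" "B \<ge> 0"
  shows "(\<integral>\<^sup>+x. ennreal (\<bar>u x\<bar> powr p) / ennreal (weight_powr (dist x\<^sub>0 x) (a * p)) \<partial>M)
           \<le> ennreal ((C\<^sup>2 * B) powr (p / 2))"
proof -
  define L where "L = (\<integral>\<^sup>+x. ennreal (\<bar>u x\<bar> powr p) / ennreal (weight_powr (dist x\<^sub>0 x) (a * p)) \<partial>M)"
  define R where "R = (\<integral>\<^sup>+x. (local_lip u x)\<^sup>2 \<partial>M)"
  obtain r where r: "R = ennreal r" "0 \<le> r" "r \<le> B"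
    using B by (cases R) (auto simp: R_def[symmetric] top_unique)
  have "enn_powr L (1 / p) \<le> ennreal C * enn_powr R (1 / 2)"
    using CKN u unfolding CKN_inequality_def L_def R_def by blast
  also have "enn_powr R (1 / 2) = ennreal (r powr (1 / 2))"
    using r by (simp add: enn_powr_def)
  also have "ennreal C * ennreal (r powr (1 / 2)) = ennreal (C * r powr (1 / 2))"
    using C by (simp add: ennreal_mult)
  finally have le: "enn_powr L (1 / p) \<le> ennreal (C * r powr (1 / 2))" .
  then obtain t where t: "L = ennreal t" "0 \<le> t"
    by (cases L) (auto simp: enn_powr_def top_unique)
  have "t powr (1 / p) \<le> C * r powr (1 / 2)"
    using le C unfolding t(1) by (simp add: enn_powr_def t(2))
  then have "(t powr (1 / p)) powr p \<le> (C * r powr (1 / 2)) powr p"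
    using p by (intro powr_mono2) auto
  also have "(t powr (1 / p)) powr p = t" using p t by (simp add: powr_powr)
  also have "(C * r powr (1 / 2)) powr p = (C\<^sup>2 * r) powr (p / 2)"
  proof -
    have "C * r powr (1 / 2) = (C\<^sup>2 * r) powr (1 / 2)"
      using C r by (simp add: powr_half_sqrt real_sqrt_mult)
    then show ?thesis by (simp add: powr_powr)
  qed
  also have "\<dots> \<le> (C\<^sup>2 * B) powr (p / 2)"
    using r p by (intro powr_mono2 mult_left_mono) auto
  finally show ?thesis using t by (simp add: L_def[symmetric] ennreal_leI)
qed

text \<open>The bubble is not admissible itself: its support is not compact, and for \<open>s < 1\<close> it is
  not Lipschitz at the centre. Clamping the radius to \<open>[\<epsilon>, R]\<close> and subtracting the
  value at \<open>R\<close> cures both without increasing the local Lipschitz constant anywhere.\<close>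

definition clamp_radius :: "real \<Rightarrow> real \<Rightarrow> real \<Rightarrow> real" where
  "clamp_radius \<epsilon> R r = max \<epsilon> (min r R)"

definition cut_bubble :: "real \<Rightarrow> real \<Rightarrow> real \<Rightarrow> real \<Rightarrow> real \<Rightarrow> real \<Rightarrow> real" where
  "cut_bubble s k l \<epsilon> R r = (l + clamp_radius \<epsilon> R r powr s) powr (- k) - (l + R powr s) powr (- k)"

lemma bubble_has_derivative:
  fixes s k l r :: real
  assumes "l > 0" "r > 0"
  shows "((\<lambda>r. (l + r powr s) powr (- k)) has_real_derivative
           - k * s * r powr (s - 1) * (l + r powr s) powr (- k - 1)) (at r)"
proof -
  have "((\<lambda>r. l + r powr s) has_real_derivative s * r powr (s - 1)) (at r)"
    using assms by (auto intro!: derivative_eq_intros)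
  from DERIV_powr[OF this _ DERIV_const[of "- k"]] show ?thesis
    using assms add_pos_pos[of l "r powr s"] by (simp add: powr_diff field_simps)
qed

text \<open>Clamping is 1-Lipschitz and fixes the points of \<open>[\<epsilon>, R]\<close>, so there the
  derivative of the uncut bubble is a bound, also at the two end points; elsewhere the function is
  locally constant. No exceptional null set arises, which matters because spheres may have positive
  measure.\<close>

lemma cut_bubble_lipschitz_estimate:
  assumes l: "l > 0" and sk: "s > 0" "k > 0" and \<epsilon>R: "0 < \<epsilon>" "\<epsilon> < R" and e: "e > 0"
  shows "eventually (\<lambda>r. \<bar>cut_bubble s k l \<epsilon> R r - cut_bubble s k l \<epsilon> R r\<^sub>0\<bar> \<le>
           (k * s * r\<^sub>0 powr (s - 1) * (l + r\<^sub>0 powr s) powr (- k - 1) + e) * \<bar>r - r\<^sub>0\<bar>) (nhds r\<^sub>0)"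
proof -
  define m where "m = k * s * r\<^sub>0 powr (s - 1) * (l + r\<^sub>0 powr s) powr (- k - 1)"
  have m: "m \<ge> 0" using sk by (simp add: m_def)
  consider "r\<^sub>0 < \<epsilon>" | "r\<^sub>0 > R" | "\<epsilon> \<le> r\<^sub>0" "r\<^sub>0 \<le> R" by linarith
  then have "eventually (\<lambda>r. \<bar>cut_bubble s k l \<epsilon> R r - cut_bubble s k l \<epsilon> R r\<^sub>0\<bar> \<le> (m + e) * \<bar>r - r\<^sub>0\<bar>) (nhds r\<^sub>0)"
  proof cases
    case 1
    then have "eventually (\<lambda>r. r < \<epsilon>) (nhds r\<^sub>0)"
      by (intro eventually_nhds_in_open[of "{..<\<epsilon>}", simplified]) auto
    then show ?thesis
      by eventually_elim (use 1 m e in \<open>auto simp: cut_bubble_def clamp_radius_def\<close>)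
  next
    case 2
    then have "eventually (\<lambda>r. r > R) (nhds r\<^sub>0)"
      by (intro eventually_nhds_in_open[of "{R<..}", simplified]) auto
    then show ?thesis
      by eventually_elim (use 2 m e in \<open>auto simp: cut_bubble_def clamp_radius_def\<close>)
  next
    case 3
    have "r\<^sub>0 > 0" using 3 \<epsilon>R by simp
    from bubble_has_derivative[OF l this, of s k]
    have "((\<lambda>r. (l + r powr s) powr (- k)) has_derivative (\<lambda>h. (- k * s * r\<^sub>0 powr (s - 1) * (l + r\<^sub>0 powr s) powr (- k - 1)) * h)) (at r\<^sub>0)"
      by (simp only: has_field_derivative_def)
    then have "\<exists>d>0. \<forall>y. norm (y - r\<^sub>0) < d \<longrightarrow>
        norm ((l + y powr s) powr (- k) - (l + r\<^sub>0 powr s) powr (- k) - (- k * s * r\<^sub>0 powr (s - 1) * (l + r\<^sub>0 powr s) powr (- k - 1)) * (y - r\<^sub>0))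
          \<le> e * norm (y - r\<^sub>0)"
      unfolding has_derivative_at_alt using e by blast
    then obtain d where d: "d > 0" "\<And>y. \<bar>y - r\<^sub>0\<bar> < d \<Longrightarrow>
        \<bar>(l + y powr s) powr (- k) - (l + r\<^sub>0 powr s) powr (- k) + m * (y - r\<^sub>0)\<bar> \<le> e * \<bar>y - r\<^sub>0\<bar>"
      by (auto simp: m_def)
    have "eventually (\<lambda>r. r \<in> ball r\<^sub>0 d) (nhds r\<^sub>0)"
      using d by (intro eventually_nhds_in_open) auto
    then show ?thesis
    proof eventually_elim
      case (elim r)
      define c where "c = clamp_radius \<epsilon> R r"
      have c: "\<bar>c - r\<^sub>0\<bar> \<le> \<bar>r - r\<^sub>0\<bar>" using 3 by (auto simp: c_def clamp_radius_def)
      have c0: "clamp_radius \<epsilon> R r\<^sub>0 = r\<^sub>0" using 3 by (auto simp: clamp_radius_def)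
      have "\<bar>c - r\<^sub>0\<bar> < d" using c elim by (simp add: dist_real_def abs_minus_commute)
      from d(2)[OF this] have "\<bar>(l + c powr s) powr (- k) - (l + r\<^sub>0 powr s) powr (- k)\<bar> \<le> e * \<bar>c - r\<^sub>0\<bar> + \<bar>m * (c - r\<^sub>0)\<bar>"
        by linarith
      also have "\<dots> = (m + e) * \<bar>c - r\<^sub>0\<bar>" using m by (simp add: abs_mult distrib_right)
      also have "\<dots> \<le> (m + e) * \<bar>r - r\<^sub>0\<bar>" using c m e by (intro mult_left_mono) auto
      finally show ?case by (simp add: cut_bubble_def c0 c_def[symmetric])
    qed
  qed
  then show ?thesis by (simp add: m_def)
qed

lemma cut_bubble_in_Lip0:
  fixes x\<^sub>0 :: "'a::metric_space"
  assumes proper: "proper_space TYPE('a)" and l: "l > 0" and \<epsilon>R: "0 < \<epsilon>" "\<epsilon> < R"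
  shows "(\<lambda>x. cut_bubble s k l \<epsilon> R (dist x\<^sub>0 x)) \<in> Lip0"
proof -
  let ?u = "\<lambda>x. cut_bubble s k l \<epsilon> R (dist x\<^sub>0 x)"
  let ?g' = "\<lambda>r. - k * s * r powr (s - 1) * (l + r powr s) powr (- k - 1)"
  have pos: "l + r powr s \<noteq> 0" for r using l powr_ge_zero[of r s] by linarith
  have "continuous_on {\<epsilon>..R} ?g'"
    using \<epsilon>R pos by (intro continuous_intros) auto
  then have "bounded (?g' ` {\<epsilon>..R})"
    by (intro compact_imp_bounded compact_continuous_image) auto
  then obtain B where "\<forall>y\<in>?g' ` {\<epsilon>..R}. norm y \<le> B"
    unfolding bounded_iff by blast
  then have B: "\<bar>?g' r\<bar> \<le> B" if "r \<in> {\<epsilon>..R}" for r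
    using that by (simp only: ball_simps real_norm_def)
  have B0: "B \<ge> 0" using order_trans[OF abs_ge_zero B[of R]] \<epsilon>R by simp
  have lip: "\<bar>(l + r powr s) powr (- k) - (l + t powr s) powr (- k)\<bar> \<le> B * \<bar>r - t\<bar>"
    if "r \<in> {\<epsilon>..R}" "t \<in> {\<epsilon>..R}" for r t
  proof -
    have "norm ((l + r powr s) powr (- k) - (l + t powr s) powr (- k)) \<le> B * norm (r - t)"
    proof (rule field_differentiable_bound[where S = "{\<epsilon>..R}" and f' = ?g'])
      fix z assume "z \<in> {\<epsilon>..R}"
      then show "((\<lambda>r. (l + r powr s) powr (- k)) has_field_derivative ?g' z) (at z within {\<epsilon>..R})"
        using \<epsilon>R by (intro has_field_derivative_at_within[OF bubble_has_derivative[OF l]]) auto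
    next
      fix z assume "z \<in> {\<epsilon>..R}"
      then show "norm (?g' z) \<le> B" unfolding real_norm_def by (rule B)
    qed (use that in simp_all)
    then show ?thesis by simp
  qed
  have "B-lipschitz_on UNIV ?u"
  proof (rule lipschitz_onI)
    fix x y :: 'a
    let ?c = "\<lambda>x. clamp_radius \<epsilon> R (dist x\<^sub>0 x)"
    have "\<bar>?u x - ?u y\<bar> \<le> B * \<bar>?c x - ?c y\<bar>"
      using lip[of "?c x" "?c y"] \<epsilon>R by (auto simp: cut_bubble_def clamp_radius_def)
    also have "\<dots> \<le> B * \<bar>dist x\<^sub>0 x - dist x\<^sub>0 y\<bar>"
      by (intro mult_left_mono B0) (auto simp: clamp_radius_def)
    also have "\<dots> \<le> B * dist x y"
      using dist_triangle[of x\<^sub>0 y x] dist_triangle[of x\<^sub>0 x y]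
      by (intro mult_left_mono B0) (auto simp: dist_commute abs_le_iff)
    finally show "dist (?u x) (?u y) \<le> B * dist x y" by (simp add: dist_real_def)
  qed (rule B0)
  moreover have "compact (closure {x. ?u x \<noteq> 0})"
  proof -
    have "{x. ?u x \<noteq> 0} \<subseteq> cball x\<^sub>0 R"
    proof
      fix x assume "x \<in> {x. ?u x \<noteq> 0}"
      then show "x \<in> cball x\<^sub>0 R"
        using \<epsilon>R by (auto simp: cut_bubble_def clamp_radius_def max_def min_def split: if_splits)
    qed
    then have "bounded {x. ?u x \<noteq> 0}" using bounded_cball bounded_subset by blast
    then show ?thesis using proper unfolding proper_space_def by auto
  qed
  ultimately show ?thesis unfolding Lip0_def by auto
qed

text \<open>The derivative of $(\lambda + r^s)^{-k}$ squared has the factor $r^{2s-2} = r^{s-q}$, as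
  $s = 2 - q$.\<close>

lemma cut_bubble_energy:
  fixes x\<^sub>0 x :: "'a::metric_space"
  assumes l: "l > 0" and sk: "s > 0" "k > 0" and \<epsilon>R: "0 < \<epsilon>" "\<epsilon> < R" and N: "N = 2 * k + 2" and q: "s = 2 - q"
  shows "(local_lip (\<lambda>x. cut_bubble s k l \<epsilon> R (dist x\<^sub>0 x)) x)\<^sup>2 \<le>
      ennreal ((s * k)\<^sup>2 * (dist x\<^sub>0 x powr (s - q) * (l + dist x\<^sub>0 x powr s) powr (- N)))"
proof -
  define r where "r = dist x\<^sub>0 x"
  define m where "m = k * s * r powr (s - 1) * (l + r powr s) powr (- k - 1)"
  have m: "m \<ge> 0" using sk by (simp add: m_def)
  have "local_lip (\<lambda>x. cut_bubble s k l \<epsilon> R (dist x\<^sub>0 x)) x \<le> ennreal m"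
    unfolding m_def r_def using sk
    by (intro local_lip_radial_le cut_bubble_lipschitz_estimate assms) auto
  then have "(local_lip (\<lambda>x. cut_bubble s k l \<epsilon> R (dist x\<^sub>0 x)) x)\<^sup>2 \<le> (ennreal m)\<^sup>2"
    by (intro power_mono) auto
  also have "\<dots> = ennreal (m\<^sup>2)" using m by (simp add: ennreal_power)
  also have "m\<^sup>2 = (s * k)\<^sup>2 * (r powr (s - q) * (l + r powr s) powr (- N))"
  proof -
    have "r powr (s - 1) * r powr (s - 1) = r powr (s - q)"
      "(l + r powr s) powr (- k - 1) * (l + r powr s) powr (- k - 1) = (l + r powr s) powr (- N)"
      unfolding powr_add[symmetric] N by (simp_all add: q)
    then show ?thesis unfolding m_def power2_eq_square by (simp add: mult_ac)
  qed
  finally show ?thesis by (simp add: r_def)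
qed

lemma CKN_bubble_cut:
  fixes M :: "'a::metric_space measure"
  assumes proper: "proper_space TYPE('a)" and CKN: "CKN_inequality M x\<^sub>0 a p C"
    and C: "C \<ge> 0" and p: "p > 0"
    and l: "l > 0" and s: "s = 2 - a * p" "s > 0" and k: "k > 0"
    and N: "N = 2 * k + 2" and \<epsilon>R: "0 < \<epsilon>" "\<epsilon> < R"
    and B: "(\<integral>\<^sup>+x. ennreal (dist x\<^sub>0 x powr (s - a * p) * (l + dist x\<^sub>0 x powr s) powr (- N)) \<partial>M) \<le> ennreal B"
    and B0: "B \<ge> 0" and sets[measurable_cong]: "sets M = sets borel"
  shows "(\<integral>\<^sup>+x. ennreal (\<bar>cut_bubble s k l \<epsilon> R (dist x\<^sub>0 x)\<bar> powr p) / 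
            ennreal (weight_powr (dist x\<^sub>0 x) (a * p)) \<partial>M)
           \<le> ennreal ((C\<^sup>2 * (s * k)\<^sup>2 * B) powr (p / 2))"
proof -
  have [measurable]: "(\<lambda>x. dist x\<^sub>0 x) \<in> borel_measurable M"
    using borel_measurable_continuous_onI[of "\<lambda>x. dist x\<^sub>0 x"] sets
    by (simp add: continuous_intros cong: measurable_cong_sets)
  have "(\<integral>\<^sup>+x. (local_lip (\<lambda>x. cut_bubble s k l \<epsilon> R (dist x\<^sub>0 x)) x)\<^sup>2 \<partial>M) \<le>
     (\<integral>\<^sup>+x. ennreal ((s * k)\<^sup>2) * ennreal (dist x\<^sub>0 x powr (s - a * p) * (l + dist x\<^sub>0 x powr s) powr (- N)) \<partial>M)"
    using cut_bubble_energy[OF l s(2) k \<epsilon>R N s(1)]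
    by (intro nn_integral_mono) (simp add: ennreal_mult)
  also have "\<dots> = ennreal ((s * k)\<^sup>2) * (\<integral>\<^sup>+x. ennreal (dist x\<^sub>0 x powr (s - a * p) * (l + dist x\<^sub>0 x powr s) powr (- N)) \<partial>M)"
    by (intro nn_integral_cmult) measurable
  also have "\<dots> \<le> ennreal ((s * k)\<^sup>2) * ennreal B" by (intro mult_left_mono B) auto
  also have "\<dots> = ennreal ((s * k)\<^sup>2 * B)" using B0 by (simp add: ennreal_mult)
  finally have "(\<integral>\<^sup>+x. (local_lip (\<lambda>x. cut_bubble s k l \<epsilon> R (dist x\<^sub>0 x)) x)\<^sup>2 \<partial>M) \<le> ennreal ((s * k)\<^sup>2 * B)" .
  from CKN_inequality_bound[OF CKN cut_bubble_in_Lip0[OF proper l \<epsilon>R] p C this]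
  show ?thesis using B0 by (simp add: mult.assoc)
qed

text \<open>Fatou's lemma removes the cut-off; the right-hand side is already independent of it. At
  \<open>x\<^sub>0\<close> the integrands of the cut-off bubbles do not tend to the integrand of the
  bubble, and this is where the nullity of that point is used.\<close>

lemma CKN_bubble:
  fixes M :: "'a::metric_space measure"
  assumes proper: "proper_space TYPE('a)" and CKN: "CKN_inequality M x\<^sub>0 a p C"
    and C: "C \<ge> 0" and p: "p > 0"
    and l: "l > 0" and s: "s = 2 - a * p" "s > 0" and k: "k > 0"
    and N: "N = 2 * k + 2" "p * k = N"
    and B: "(\<integral>\<^sup>+x. ennreal (dist x\<^sub>0 x powr (s - a * p) * (l + dist x\<^sub>0 x powr s) powr (- N)) \<partial>M) \<le> ennreal B"
    and B0: "B \<ge> 0" and sets[measurable_cong]: "sets M = sets borel"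
    and AE: "AE x in M. dist x\<^sub>0 x > 0"
  shows "(\<integral>\<^sup>+x. ennreal (dist x\<^sub>0 x powr (- (a * p)) * (l + dist x\<^sub>0 x powr s) powr (- N)) \<partial>M)
           \<le> ennreal ((C\<^sup>2 * (s * k)\<^sup>2 * B) powr (p / 2))"
proof -
  have [measurable]: "(\<lambda>x. dist x\<^sub>0 x) \<in> borel_measurable M"
    using borel_measurable_continuous_onI[of "\<lambda>x. dist x\<^sub>0 x"] sets
    by (simp add: continuous_intros cong: measurable_cong_sets)
  define u where "u j r = cut_bubble s k l (1 / real (j + 2)) (real (j + 2)) r" for j r
  define f where "f j x = ennreal (\<bar>u j (dist x\<^sub>0 x)\<bar> powr p) / ennreal (weight_powr (dist x\<^sub>0 x) (a * p))" for j x
  have f_meas [measurable]: "f j \<in> borel_measurable M" for j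
    unfolding f_def u_def cut_bubble_def clamp_radius_def weight_powr_def by measurable
  have lim: "(\<lambda>j. f j x) \<longlonglongrightarrow> ennreal (dist x\<^sub>0 x powr (- (a * p)) * (l + dist x\<^sub>0 x powr s) powr (- N))"
    if d: "dist x\<^sub>0 x > 0" for x
  proof -
    define r where "r = dist x\<^sub>0 x"
    have r: "r > 0" using d by (simp add: r_def)
    have pos: "l + r powr s > 0" using l by (simp add: add_pos_nonneg)
    have w: "weight_powr r (a * p) = r powr (a * p)" using r by (simp add: weight_powr_def)
    have f_eq: "f j x = ennreal (\<bar>u j r\<bar> powr p * r powr (- (a * p)))" for j
      using r by (simp add: f_def w r_def[symmetric] divide_ennreal powr_minus divide_inverse)
    have tail: "(\<lambda>j. (l + real (j + 2) powr s) powr (- k)) \<longlonglongrightarrow> 0"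
      using s k l by real_asymp
    have "eventually (\<lambda>j. u j r = (l + r powr s) powr (- k) - (l + real (j + 2) powr s) powr (- k)) sequentially"
    proof -
      have "(\<lambda>j. 1 / real (j + 2)) \<longlonglongrightarrow> 0" by real_asymp
      then have "eventually (\<lambda>j. 1 / real (j + 2) < r) sequentially"
        using r by (rule order_tendstoD)
      moreover have "eventually (\<lambda>j. real (j + 2) > r) sequentially"
        by real_asymp
      ultimately show ?thesis
        by eventually_elim (simp add: u_def cut_bubble_def clamp_radius_def)
    qed
    moreover have "(\<lambda>j. (l + r powr s) powr (- k) - (l + real (j + 2) powr s) powr (- k)) \<longlonglongrightarrow> (l + r powr s) powr (- k) - 0"
      by (intro tendsto_diff tail tendsto_const)
    ultimately have "(\<lambda>j. u j r) \<longlonglongrightarrow> (l + r powr s) powr (- k)"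
      by (simp add: tendsto_cong)
    then have "(\<lambda>j. \<bar>u j r\<bar> powr p * r powr (- (a * p))) \<longlonglongrightarrow> \<bar>(l + r powr s) powr (- k)\<bar> powr p * r powr (- (a * p))"
      using pos by (intro tendsto_intros) auto
    also have "\<bar>(l + r powr s) powr (- k)\<bar> powr p = (l + r powr s) powr (- N)"
      using N(2) by (simp add: powr_powr mult.commute)
    finally show ?thesis unfolding f_eq r_def[symmetric]
      by (intro tendsto_ennrealI) (simp add: mult.commute)
  qed
  have "(\<integral>\<^sup>+x. ennreal (dist x\<^sub>0 x powr (- (a * p)) * (l + dist x\<^sub>0 x powr s) powr (- N)) \<partial>M) =
      (\<integral>\<^sup>+x. liminf (\<lambda>j. f j x) \<partial>M)"
  proof (rule nn_integral_cong_AE, use AE in eventually_elim)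
    case (elim x)
    show ?case using lim_imp_Liminf[OF _ lim[OF elim]] by simp
  qed
  also have "\<dots> \<le> liminf (\<lambda>j. \<integral>\<^sup>+x. f j x \<partial>M)"
    by (intro nn_integral_liminf) auto
  also have "\<dots> \<le> liminf (\<lambda>j. ennreal ((C\<^sup>2 * (s * k)\<^sup>2 * B) powr (p / 2)))"
  proof (intro Liminf_mono always_eventually allI)
    fix j
    have "1 / real (j + 2) < real (j + 2)" by (simp add: field_simps add_strict_increasing)
    then show "(\<integral>\<^sup>+x. f j x \<partial>M) \<le> ennreal ((C\<^sup>2 * (s * k)\<^sup>2 * B) powr (p / 2))"
      unfolding f_def u_def by (intro CKN_bubble_cut[OF proper CKN C p l s k N(1) _ _ B B0 sets]) auto
  qed
  also have "\<dots> = ennreal ((C\<^sup>2 * (s * k)\<^sup>2 * B) powr (p / 2))" by (simp add: Liminf_const)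
  finally show ?thesis .
qed

section \<open>Exponents and the optimal constant\<close>

text \<open>A multiple $X \Gamma$ of the Euclidean mass scales the two sides of the equation by
  $X^{1-2/N}$ and $X$, so replacing the constant $K$ by $C$ corresponds to $X = (K/C)^N$. The
  hypotheses \<open>K2\<close> and \<open>T\<Gamma>\<close> express that $X = 1$ belongs to $K$.\<close>

lemma critical_mass:
  fixes N k T \<Gamma> C K \<sigma> :: real
  assumes N: "N > 2" and k: "k = N / 2 - 1" and C: "C > 0" and K: "K > 0" and T: "T > 0" and \<Gamma>: "\<Gamma> > 0"
    and K2: "K\<^sup>2 * \<sigma>\<^sup>2 = k / (N / 2) * T powr (2 / N)"
    and T\<Gamma>: "k * \<Gamma> / (N - 1) = 1 / T"
  shows "(k * ((K / C) powr N * \<Gamma>) / (N - 1)) powr (1 - 2 / N) =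
     C\<^sup>2 * \<sigma>\<^sup>2 * ((K / C) powr N * \<Gamma> - k * ((K / C) powr N * \<Gamma>) / (N - 1))"
proof -
  define X where "X = (K / C) powr N"
  have X: "X > 0" using K C by (simp add: X_def)
  have kpos: "k > 0" using N k by simp
  have "X powr (- (2 / N)) = (K / C) powr (- 2)"
    using N K C by (simp add: X_def powr_powr)
  also have "\<dots> = C\<^sup>2 / K\<^sup>2"
    using K C by (simp add: powr_minus powr_divide field_simps)
  finally have X2: "X powr (- (2 / N)) = C\<^sup>2 / K\<^sup>2" .
  have \<Gamma>eq: "\<Gamma> = (N - 1) / (k * T)" using T\<Gamma> N kpos T by (simp add: field_simps)
  have "(k * (X * \<Gamma>) / (N - 1)) powr (1 - 2 / N) = (X / T) powr (1 - 2 / N)"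
    using N kpos by (simp add: \<Gamma>eq)
  also have "\<dots> = X / T * (X powr (- (2 / N)) * T powr (2 / N))"
  proof -
    have "(X / T) powr (1 - 2 / N) = X powr (1 - 2 / N) / T powr (1 - 2 / N)"
      using X T by (simp add: powr_divide)
    then show ?thesis using X T by (simp add: powr_diff powr_minus divide_inverse)
  qed
  also have "\<dots> = X / T * (C\<^sup>2 / K\<^sup>2 * (K\<^sup>2 * \<sigma>\<^sup>2 * (N / 2) / k))"
    unfolding X2 K2 using kpos N by simp
  also have "\<dots> = X / T * (C\<^sup>2 * \<sigma>\<^sup>2 * (N / 2) / k)"
    using K by simp
  also have "\<dots> = C\<^sup>2 * \<sigma>\<^sup>2 * (X * \<Gamma> - k * (X * \<Gamma>) / (N - 1))"
  proof -
    have "X * \<Gamma> - k * (X * \<Gamma>) / (N - 1) = X * (\<Gamma> - k * \<Gamma> / (N - 1))" by (simp add: algebra_simps)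
    also have "\<Gamma> - k * \<Gamma> / (N - 1) = (N - 1) / (k * T) - 1 / T" unfolding T\<Gamma> by (simp add: \<Gamma>eq)
    also have "\<dots> = (N - 1 - k) / (k * T)" using kpos T by (simp add: field_simps)
    also have "N - 1 - k = N / 2" using k by simp
    finally show ?thesis by (simp add: mult_ac)
  qed
  finally show ?thesis by (simp add: X_def)
qed

lemma CKN_exponents:
  fixes m a p q s N k :: real
  assumes m: "m \<ge> 3" and a: "0 \<le> a" "a < 1" and p: "p = 2 * m / (m - 2 + 2 * a)"
    and q: "q = a * p" and s: "s = 2 - q" and N: "N = m / (1 - a)" and k: "k = N / 2 - 1"
  shows "p > 0" "q \<ge> 0" "s > 0" "N > 2" "k > 0" "s * k = m - 2" "p * k = N" "m - q = s * N / 2"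
    "p / 2 = 1 / (1 - 2 / N)"
proof -
  have den: "m - 2 + 2 * a > 0" using m a by linarith
  show p0: "p > 0" unfolding p using m den by simp
  show "q \<ge> 0" using a p0 by (simp add: q)
  have s_eq: "s = 2 * (m - 2) * (1 - a) / (m - 2 + 2 * a)"
    using den by (simp add: s q p field_simps)
  show "s > 0" unfolding s_eq using m a den by simp
  show N2: "N > 2" unfolding N using m a by (simp add: field_simps)
  then show k0: "k > 0" by (simp add: k)
  have k_eq: "k = (m - 2 + 2 * a) / (2 * (1 - a))" using a by (simp add: k N field_simps)
  show "s * k = m - 2"
  proof -
    have "2 * x * z / y * (y / (2 * z)) = x" if "y \<noteq> 0" "z \<noteq> 0" for x y z :: real using that by simp
    from this[of "m - 2 + 2 * a" "1 - a" "m - 2"] show ?thesis unfolding s_eq k_eq using den a by linarith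
  qed
  show pk: "p * k = N"
  proof -
    have "2 * x / y * (y / (2 * z)) = x / z" if "y \<noteq> 0" for x y z :: real using that by simp
    from this[of "m - 2 + 2 * a" m "1 - a"] show ?thesis unfolding p k_eq N using den by linarith
  qed
  show "m - q = s * N / 2"
  proof -
    have "2 * x * z / y * (w / z) / 2 = x * w / y" if "z \<noteq> 0" for x y z w :: real using that by simp
    from this[of "1 - a" "m - 2" "m - 2 + 2 * a" m]
    have "s * N / 2 = (m - 2) * m / (m - 2 + 2 * a)" unfolding s_eq N using a by linarith
    also have "\<dots> = m - a * (2 * m / (m - 2 + 2 * a))" using den by (simp add: field_simps)
    finally show ?thesis by (simp add: q p)
  qed
  show "p / 2 = 1 / (1 - 2 / N)"
    using pk N2 k0 by (simp add: k field_simps)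
qed

text \<open>The constant is tuned to the Euclidean bubbles: by the functional equation of the Gamma function,
  the fraction of Gamma values in its definition equals $(N-1)/(k \Gamma)$.\<close>

lemma CKN_const_critical:
  fixes n :: nat and a p s N C' :: real
  defines "K \<equiv> CKN_const n a p"
  defines "\<Gamma> \<equiv> unit_ball_vol (real n) * (real n / s) * Beta (N / 2) (N / 2 - 1)"
  assumes n: "n \<ge> 3" and s: "s = 2 - a * p" "s > 0" and N: "N > 2"
    and mq: "real n - a * p = s * N / 2" and sk: "s * (N / 2 - 1) = real n - 2"
  shows "K > 0"
    and "C' > 0 \<Longrightarrow> ((N / 2 - 1) * ((K / C') powr N * \<Gamma>) / (N - 1)) powr (1 - 2 / N) =
       C'\<^sup>2 * (s * (N / 2 - 1))\<^sup>2 *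
         ((K / C') powr N * \<Gamma> - (N / 2 - 1) * ((K / C') powr N * \<Gamma>) / (N - 1))"
proof -
  define m where "m = real n"
  define v where "v = unit_ball_vol m"
  define k where "k = N / 2 - 1"
  have v: "v > 0" by (simp add: v_def m_def)
  have m: "m \<ge> 3" using n by (simp add: m_def)
  have k0: "k > 0" using N by (simp add: k_def)
  have s0: "s > 0" by fact
  have N2: "N > 2" by fact
  have mq: "m - a * p = s * N / 2" using mq by (simp add: m_def)
  have sk: "s * k = m - 2" using sk by (simp add: m_def k_def)
  have mq0: "m - a * p > 0" unfolding mq using s0 N2 by simp
  \<comment> \<open>the fraction in the definition of the constant\<close>
  define T where "T = s * Gamma N / (m * v * (Gamma (N / 2))\<^sup>2)"
  have T: "T > 0"
    unfolding T_def using s0 v m N2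
    by (intro divide_pos_pos mult_pos_pos zero_less_power Gamma_real_pos) auto
  have K_eq: "K = (1 / ((m - 2) * (m - a * p))) powr (1 / 2) * T powr (1 / N)"
  proof -
    have e: "(2 * real n - 2 * a * p) / (2 - a * p) = N" "(real n - a * p) / (2 - a * p) = N / 2"
        "(2 - a * p) / (2 * real n - 2 * a * p) = 1 / N"
    proof -
      have 1: "real n - a * p = s * N / 2" using mq by (simp add: m_def)
      have 2: "2 - a * p = s" by (simp add: s)
      have 3: "2 * real n - 2 * a * p = s * N" using 1 by (simp add: field_simps)
      show "(2 * real n - 2 * a * p) / (2 - a * p) = N" "(real n - a * p) / (2 - a * p) = N / 2"
        "(2 - a * p) / (2 * real n - 2 * a * p) = 1 / N"
        unfolding 1 2 3 using s0 N2 by simp_all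
    qed
    show ?thesis
      unfolding K_def CKN_const_def e T_def m_def v_def s by (rule refl)
  qed
  show K: "K > 0" unfolding K_eq using T m mq0 by simp
  have K2: "K\<^sup>2 * (s * k)\<^sup>2 = k / (N / 2) * T powr (2 / N)"
  proof -
    have "K\<^sup>2 = (1 / ((m - 2) * (m - a * p))) * T powr (2 / N)"
      unfolding K_eq using m mq0 T
      by (simp add: power_mult_distrib powr_half_sqrt flip: powr_numeral) (simp add: powr_powr)
    then have K2: "K\<^sup>2 = 1 / ((s * k) * (s * N / 2)) * T powr (2 / N)" by (simp only: sk mq)
    show ?thesis
      unfolding K2 using s0 k0 N2 by (simp add: power2_eq_square field_simps)
  qed
  have \<Gamma>: "\<Gamma> > 0" using v m s0 N2 by (simp add: \<Gamma>_def v_def m_def Beta_def Gamma_real_pos)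
  have T\<Gamma>: "k * \<Gamma> / (N - 1) = 1 / T"
  proof -
    have 1: "Gamma (N / 2) = k * Gamma (N / 2 - 1)"
      using Gamma_plus1[of "N / 2 - 1"] nonpos_Ints_nonpos[of "N / 2 - 1"] k0
      by (fastforce simp: k_def)
    have 2: "Gamma N = (N - 1) * Gamma (N - 1)"
      using Gamma_plus1[of "N - 1"] nonpos_Ints_nonpos[of "N - 1"] N2 by fastforce
    have "N / 2 + (N / 2 - 1) = N - 1" by simp
    then have 3: "Beta (N / 2) (N / 2 - 1) = k * Gamma (N / 2 - 1) * Gamma (N / 2 - 1) / Gamma (N - 1)"
      by (simp only: Beta_def 1)
    have "k * (v * (m / s) * (k * g * g / h)) / (N - 1) = 1 / (s * ((N - 1) * h) / (m * v * (k * g)\<^sup>2))"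
      if "g > 0" "h > 0" for g h
      using that N2 k0 s0 v m by (simp add: power2_eq_square mult_ac)
    from this[of "Gamma (N / 2 - 1)" "Gamma (N - 1)"] show ?thesis
      unfolding \<Gamma>_def m_def[symmetric] v_def[symmetric] T_def 1 2 3 using N2 by (simp add: Gamma_real_pos)
  qed

  show "((N / 2 - 1) * ((K / C') powr N * \<Gamma>) / (N - 1)) powr (1 - 2 / N) =
       C'\<^sup>2 * (s * (N / 2 - 1))\<^sup>2 *
         ((K / C') powr N * \<Gamma> - (N / 2 - 1) * ((K / C') powr N * \<Gamma>) / (N - 1))" if "C' > 0"
    using critical_mass[OF N2 k_def that K T \<Gamma> K2 T\<Gamma>] by (simp only: k_def)
qed


section \<open>From large balls to all balls\<close>

text \<open>A large ball about \<open>x\<^sub>0\<close> of radius \<open>R\<close> lies in the ball about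
  \<open>x\<close> of radius \<open>R + dist x\<^sub>0 x\<close>, and doubling compares the latter with the ball
  of radius \<open>\<rho>\<close>. The change of centre costs nothing in the limit of large
  \<open>R\<close>.\<close>

lemma measure_ball_ge_of_growth:
  fixes M :: "'a::metric_space measure"
  assumes borel: "sets M = sets borel" and fin: "\<And>x r. emeasure M (ball x r) < \<infinity>"
    and C\<^sub>0: "C\<^sub>0 > 0" and w: "w \<ge> 0" and \<rho>: "\<rho> > 0"
    and doubling: "\<And>x r R. 0 < r \<Longrightarrow> r < R \<Longrightarrow>
           measure M (ball x R) \<le> C\<^sub>0 * (R / r) ^ n * measure M (ball x r)"
    and growth: "\<And>R\<^sub>0. R\<^sub>0 > 0 \<Longrightarrow> \<exists>R\<ge>R\<^sub>0. w * R ^ n \<le> measure M (ball x\<^sub>0 R)"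
  shows "inverse C\<^sub>0 * (w * \<rho> ^ n) \<le> measure M (ball x \<rho>)"
proof -
  define D where "D = dist x\<^sub>0 x"
  have bound: "inverse C\<^sub>0 * (w * \<rho> ^ n) * (t / (t + D)) ^ n \<le> measure M (ball x \<rho>)" if t: "t > \<rho>" for t
  proof -
    obtain R where R: "R \<ge> t" "w * R ^ n \<le> measure M (ball x\<^sub>0 R)"
      using growth[of t] t \<rho> by auto
    have D0: "D \<ge> 0" by (simp add: D_def)
    have "w * R ^ n \<le> measure M (ball x (R + D))"
    proof -
      have "ball x\<^sub>0 R \<subseteq> ball x (R + D)"
      proof
        fix y assume "y \<in> ball x\<^sub>0 R"
        then show "y \<in> ball x (R + D)"
          using dist_triangle[of x y x\<^sub>0] by (simp add: D_def dist_commute)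
      qed
      then have "measure M (ball x\<^sub>0 R) \<le> measure M (ball x (R + D))"
        using fin by (intro measure_mono_fmeasurable) (auto simp: borel fmeasurable_def)
      then show ?thesis using R by simp
    qed
    also have "\<dots> \<le> C\<^sub>0 * ((R + D) / \<rho>) ^ n * measure M (ball x \<rho>)"
      using doubling[of \<rho> "R + D" x] \<rho> t R D0 by simp
    finally have "inverse C\<^sub>0 * (\<rho> / (R + D)) ^ n * (w * R ^ n) \<le>
        inverse C\<^sub>0 * (\<rho> / (R + D)) ^ n * (C\<^sub>0 * ((R + D) / \<rho>) ^ n * measure M (ball x \<rho>))"
      using C\<^sub>0 \<rho> t R D0 by (intro mult_left_mono) auto
    also have "\<dots> = measure M (ball x \<rho>)"
      using C\<^sub>0 \<rho> t R D0 by (simp add: power_divide)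
    also have "inverse C\<^sub>0 * (\<rho> / (R + D)) ^ n * (w * R ^ n) = inverse C\<^sub>0 * (w * \<rho> ^ n) * (R / (R + D)) ^ n"
      by (simp add: power_divide)
    finally have "inverse C\<^sub>0 * (w * \<rho> ^ n) * (R / (R + D)) ^ n \<le> measure M (ball x \<rho>)" .
    moreover have "t / (t + D) \<le> R / (R + D)"
      using \<rho> t R D0 by (simp add: field_simps mult_left_mono)
    then have "(t / (t + D)) ^ n \<le> (R / (R + D)) ^ n" using \<rho> t D0 by (intro power_mono) auto
    then have "inverse C\<^sub>0 * (w * \<rho> ^ n) * (t / (t + D)) ^ n \<le> inverse C\<^sub>0 * (w * \<rho> ^ n) * (R / (R + D)) ^ n"
      using C\<^sub>0 w \<rho> by (intro mult_left_mono) auto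
    ultimately show ?thesis by linarith
  qed
  have "((\<lambda>t. t / (t + D)) \<longlongrightarrow> 1) at_top" by real_asymp
  then have "((\<lambda>t. inverse C\<^sub>0 * (w * \<rho> ^ n) * (t / (t + D)) ^ n) \<longlongrightarrow> inverse C\<^sub>0 * (w * \<rho> ^ n) * 1 ^ n) at_top"
    by (intro tendsto_intros)
  moreover have "eventually (\<lambda>t. inverse C\<^sub>0 * (w * \<rho> ^ n) * (t / (t + D)) ^ n \<le> measure M (ball x \<rho>)) at_top"
    using eventually_gt_at_top[of \<rho>] by eventually_elim (rule bound)
  ultimately have "inverse C\<^sub>0 * (w * \<rho> ^ n) * 1 ^ n \<le> measure M (ball x \<rho>)"
    by (rule tendsto_upperbound) simp
  then show ?thesis by simp
  qed


theorem theorem1p1: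
  fixes M :: "'a::metric_space measure"
    and x\<^sub>0 :: 'a
    and n :: nat
    and a p C C\<^sub>0 :: real
  assumes dim: "n = CARD('n::finite)"
    and n: "n \<ge> 3"
    and a: "0 \<le> a" "a < 1"
    and p: "p = 2 * real n / (real n - 2 + 2 * a)"
    and proper: "proper_space TYPE('a)"
    and borel: "sets M = sets borel"
    and pos_fin: "\<And>U. open U \<Longrightarrow> bounded U \<Longrightarrow> U \<noteq> {} \<Longrightarrow> 0 < emeasure M U \<and> emeasure M U < \<infinity>"
    and C: "C \<ge> CKN_const n a p"
    and C\<^sub>0: "C\<^sub>0 \<ge> 1"
    and CKN: "CKN_inequality M x\<^sub>0 a p C"
    and doubling: "\<And>x r R. 0 < r \<Longrightarrow> r < R \<Longrightarrow>
           measure M (ball x R) / measure M (ball x r) \<le> C\<^sub>0 * (R / r) ^ n"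
    and density: "Liminf (at_right 0) (\<lambda>r. ereal (measure M (ball x\<^sub>0 r) /
           measure lebesgue (ball (0 :: real ^ 'n) r))) = 1"
  shows "(\<forall>x. \<forall>\<rho>>0. measure M (ball x \<rho>) \<ge>
            inverse C\<^sub>0 * (inverse C * CKN_const n a p) powr (real n / (1 - a)) *
            measure lebesgue (ball (0 :: real ^ 'n) \<rho>)) \<and>
         (\<forall>\<rho>>0. inverse C\<^sub>0 * (inverse C * CKN_const n a p) powr (real n / (1 - a)) *
              unit_ball_vol (real n) * \<rho> ^ n \<le> measure M (ball x\<^sub>0 \<rho>) \<and>
            measure M (ball x\<^sub>0 \<rho>) \<le> C\<^sub>0 * unit_ball_vol (real n) * \<rho> ^ n)"
proof -
  define v where "v = unit_ball_vol (real n)"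
  define q where "q = a * p"
  define s where "s = 2 - q"
  define N where "N = real n / (1 - a)"
  define k where "k = N / 2 - 1"
  define K where "K = CKN_const n a p"
  define m where "m = real n"
  have v: "v > 0" by (simp add: v_def)
  have m: "m \<ge> 3" using n by (simp add: m_def)
  note exps = CKN_exponents[OF m a p[folded m_def] q_def s_def N_def[folded m_def] k_def]
  note p0 = exps(1) and q0 = exps(2) and s0 = exps(3) and N2 = exps(4) and k0 = exps(5)
    and sk = exps(6) and pk = exps(7) and mq = exps(8) and pN = exps(9)
  note critical = CKN_const_critical[OF n s_def[unfolded q_def] s0 N2
    mq[unfolded q_def m_def] sk[unfolded k_def m_def]]
  have K: "K > 0" unfolding K_def by (rule critical)

  have vol_n: "measure lborel (ball (0 :: real ^ 'n) r) = v * r ^ n" if "r > 0" for r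
    using that content_ball[of r "0 :: real ^ 'n"] dim by (simp add: v_def)
  have fin: "emeasure M (ball x r) < \<infinity>" for x r
    using pos_fin[of "ball x r"] by (cases "r > 0") (auto simp: ball_empty not_less)
  have em: "emeasure M (ball x r) = ennreal (measure M (ball x r))" for x r
    using fin[of x r] by (intro emeasure_eq_ennreal_measure) auto
  have pos: "measure M (ball x r) > 0" if "r > 0" for x r
    using pos_fin[of "ball x r"] that em[of x r] by (simp add: ennreal_zero_less_mult_iff)
  have doubling': "measure M (ball x R) \<le> C\<^sub>0 * (R / r) ^ n * measure M (ball x r)" if "0 < r" "r < R" for x r R
    using doubling[OF that, of x] pos[OF that(1), of x] by (simp add: divide_le_eq)

  \<comment> \<open>the limit inferior is used from both sides: it bounds all small balls from below, and some arbitrarily small ones from above\<close>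
  have near0: "eventually (\<lambda>r. c * (v * r ^ n) \<le> measure M (ball x\<^sub>0 r)) (at_right 0)" if "c < 1" for c
  proof -
    have "eventually (\<lambda>r. ereal c < ereal (measure M (ball x\<^sub>0 r) / measure lebesgue (ball (0 :: real ^ 'n) r))) (at_right 0)"
      using density that by (intro less_LiminfD) simp
    moreover have "eventually (\<lambda>r::real. r > 0) (at_right 0)" by (rule eventually_at_right_less)
    ultimately show ?thesis
      by eventually_elim (use v in \<open>simp add: vol_n field_simps\<close>)
  qed
  have freq0: "frequently (\<lambda>r. measure M (ball x\<^sub>0 r) \<le> c * (v * r ^ n)) (at_right 0)" if "c > 1" for c
  proof (rule ccontr)
    assume "\<not> ?thesis"
    then have "eventually (\<lambda>r. c * (v * r ^ n) < measure M (ball x\<^sub>0 r)) (at_right 0)"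
      by (simp add: not_frequently not_le)
    moreover have "eventually (\<lambda>r::real. r > 0) (at_right 0)" by (rule eventually_at_right_less)
    ultimately have "eventually (\<lambda>r. ereal c \<le> ereal (measure M (ball x\<^sub>0 r) / measure lebesgue (ball (0 :: real ^ 'n) r))) (at_right 0)"
      by eventually_elim (use v in \<open>simp add: vol_n field_simps\<close>)
    from Liminf_bounded[OF this] show False using density that by simp
  qed
  have upper: "measure M (ball x\<^sub>0 \<rho>) \<le> C\<^sub>0 * (v * \<rho> ^ n)" if \<rho>: "\<rho> > 0" for \<rho>
  proof (rule field_le_mult_one_interval)
    fix z :: real assume z: "0 < z" "z < 1"
    have "eventually (\<lambda>r. r \<in> {0<..<\<rho>}) (at_right 0)" using \<rho> by (rule eventually_at_right_real)
    with freq0[of "1 / z"] have "frequently (\<lambda>r. measure M (ball x\<^sub>0 r) \<le> 1 / z * (v * r ^ n) \<and> r \<in> {0<..<\<rho>}) (at_right 0)"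
      using z by (intro frequently_eventually_frequently) auto
    then obtain r where r: "measure M (ball x\<^sub>0 r) \<le> 1 / z * (v * r ^ n)" "0 < r" "r < \<rho>"
      using frequently_ex by fastforce
    have "measure M (ball x\<^sub>0 \<rho>) \<le> C\<^sub>0 * (\<rho> / r) ^ n * measure M (ball x\<^sub>0 r)"
      using doubling'[OF r(2,3)] .
    also have "\<dots> \<le> C\<^sub>0 * (\<rho> / r) ^ n * (1 / z * (v * r ^ n))"
      using r C\<^sub>0 \<rho> by (intro mult_left_mono) auto
    also have "\<dots> = C\<^sub>0 * (v * \<rho> ^ n) / z" using r by (simp add: power_divide)
    finally show "z * measure M (ball x\<^sub>0 \<rho>) \<le> C\<^sub>0 * (v * \<rho> ^ n)"
      using z by (simp add: field_simps)
  qed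

  have sp: "space M = UNIV" using sets_eq_imp_space_eq[OF borel] by simp
  have ball_eq: "{x \<in> space M. dist x\<^sub>0 x < \<rho>} = ball x\<^sub>0 \<rho>" for \<rho> by (auto simp: sp)
  have d_meas: "dist x\<^sub>0 \<in> borel_measurable M"
    using borel_measurable_continuous_onI[of "dist x\<^sub>0"] borel
    by (simp add: continuous_intros cong: measurable_cong_sets)
  have sf: "sigma_finite_measure M"
  proof (rule sigma_finite_measure.intro, intro exI conjI ballI)
    let ?A = "range (\<lambda>i::nat. ball x\<^sub>0 (real i))"
    show "countable ?A" by simp
    show "?A \<subseteq> sets M" by (auto simp: borel)
    show "\<Union>?A = space M" using reals_Archimedean2 by (auto simp: sp)
    fix A assume "A \<in> ?A" then show "emeasure M A \<noteq> \<infinity>" using fin by (auto simp: less_top)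
  qed
  \<comment> \<open>the volume bound forces the centre, where the weight is singular for \<open>a > 0\<close>, to be a null set\<close>
  have AE: "AE x in M. dist x\<^sub>0 x > 0"
  proof -
    have "emeasure M {x\<^sub>0} = 0"
    proof (rule ccontr)
      assume ne: "emeasure M {x\<^sub>0} \<noteq> 0"
      have le: "emeasure M {x\<^sub>0} \<le> ennreal (C\<^sub>0 * (v * \<rho> ^ n))" if "\<rho> > 0" for \<rho>
      proof -
        have "emeasure M {x\<^sub>0} \<le> emeasure M (ball x\<^sub>0 \<rho>)" using that by (intro emeasure_mono) (auto simp: borel)
        also have "\<dots> \<le> ennreal (C\<^sub>0 * (v * \<rho> ^ n))" using upper[OF that] em by (simp add: ennreal_leI)
        finally show ?thesis .
      qed
      obtain e where e: "emeasure M {x\<^sub>0} = ennreal e" "e > 0"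
        using le[of 1] ne by (cases "emeasure M {x\<^sub>0}") (auto simp: top_unique less_le)
      have "((\<lambda>\<rho>. C\<^sub>0 * (v * \<rho> ^ n)) \<longlongrightarrow> C\<^sub>0 * (v * 0 ^ n)) (at_right 0)"
        by (intro tendsto_intros)
      then have "((\<lambda>\<rho>. C\<^sub>0 * (v * \<rho> ^ n)) \<longlongrightarrow> 0) (at_right 0)" using n by (simp add: power_0_left)
      then have "eventually (\<lambda>\<rho>. C\<^sub>0 * (v * \<rho> ^ n) < e) (at_right 0)" using e(2) by (rule order_tendstoD)
      moreover have "eventually (\<lambda>r::real. r > 0) (at_right 0)" by (rule eventually_at_right_less)
      ultimately have "eventually (\<lambda>\<rho>::real. False) (at_right 0)"
      proof eventually_elim
        case (elim \<rho>)
        have "e \<le> C\<^sub>0 * (v * \<rho> ^ n)" using le[OF elim(2)] e elim C\<^sub>0 v by (simp add: ennreal_le_iff)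
        then show False using elim by simp
      qed
      then show False by simp
    qed
    then have "AE x in M. x \<notin> {x\<^sub>0}" by (intro AE_not_in) (auto simp: null_sets_def borel)
    then show ?thesis by eventually_elim auto
  qed

  \<comment> \<open>the comparison needs \<open>(K / C') powr N < 1\<close>, hence a constant strictly larger than \<open>C\<close>\<close>
  have growth: "\<exists>R\<ge>R\<^sub>0. c * (v * R ^ n) < measure M (ball x\<^sub>0 R)"
    if C': "C' > C" and c: "0 \<le> c" "c < (K / C') powr N" and R\<^sub>0: "R\<^sub>0 > 0" for C' c R\<^sub>0
  proof -
    have C'K: "C' > K" using C' C by (simp add: K_def)
    then have C'0: "C' > 0" using K by simp
    have "\<exists>R\<ge>R\<^sub>0. emeasure M {x \<in> space M. dist x\<^sub>0 x < R} > ennreal (c * (v * R powr m))"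
    proof (rule volume_growth_at_infinity[OF sf d_meas AE v _ s0 N2 q0 mq _ _ _ _ _ _ _ _ c R\<^sub>0])
      show "0 < m" using m by simp
      show "0 \<le> C\<^sub>0" using C\<^sub>0 by simp
      show "emeasure M {x \<in> space M. dist x\<^sub>0 x < \<rho>} \<le> ennreal (C\<^sub>0 * (v * \<rho> powr m))" if "\<rho> > 0" for \<rho>
        unfolding ball_eq em using upper[OF that] that by (intro ennreal_leI) (simp add: m_def powr_realpow)
      show "\<exists>r\<^sub>0>0. \<forall>\<rho>. 0 < \<rho> \<longrightarrow> \<rho> \<le> r\<^sub>0 \<longrightarrow>
          ennreal (c * (v * \<rho> powr m)) \<le> emeasure M {x \<in> space M. dist x\<^sub>0 x < \<rho>}" if c1: "0 < c" "c < 1" for c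
      proof -
        obtain b where b: "b > 0" "\<And>r. 0 < r \<Longrightarrow> r < b \<Longrightarrow> c * (v * r ^ n) \<le> measure M (ball x\<^sub>0 r)"
          using near0[OF c1(2)] unfolding eventually_at_right_field by auto
        show ?thesis
        proof (intro exI[of _ "b / 2"] conjI allI impI)
          fix \<rho> assume "0 < \<rho>" "\<rho> \<le> b / 2"
          then show "ennreal (c * (v * \<rho> powr m)) \<le> emeasure M {x \<in> space M. dist x\<^sub>0 x < \<rho>}"
            unfolding ball_eq em using b by (intro ennreal_leI) (simp add: m_def powr_realpow)
        qed (use b in simp)
      qed
      show "0 < C'\<^sup>2 * (s * k)\<^sup>2" using C'0 s0 k0 by simp
      show "0 < (K / C') powr N" using K C'0 by simp
      show "(K / C') powr N < 1"
        using K C'0 C'K N2 powr_less_mono2[of N "K / C'" 1] by simp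
      show "((N / 2 - 1) * ((K / C') powr N * (v * (m / s) * Beta (N / 2) (N / 2 - 1))) / (N - 1)) powr (1 - 2 / N) =
          C'\<^sup>2 * (s * k)\<^sup>2 * ((K / C') powr N * (v * (m / s) * Beta (N / 2) (N / 2 - 1)) -
          (N / 2 - 1) * ((K / C') powr N * (v * (m / s) * Beta (N / 2) (N / 2 - 1))) / (N - 1))"
        using critical(2)[OF C'0] unfolding K_def k_def v_def m_def .
      fix l B :: real
      assume l: "l > 0" and B: "B \<ge> 0"
        and le: "(\<integral>\<^sup>+x. ennreal (dist x\<^sub>0 x powr (s - q) * (l + dist x\<^sub>0 x powr s) powr (- N)) \<partial>M) \<le> ennreal B"
      have C0': "C \<ge> 0" using C K by (simp add: K_def)
      have "(\<integral>\<^sup>+x. ennreal (dist x\<^sub>0 x powr (- q) * (l + dist x\<^sub>0 x powr s) powr (- N)) \<partial>M)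
          \<le> ennreal ((C\<^sup>2 * (s * k)\<^sup>2 * B) powr (p / 2))"
        unfolding q_def
        by (rule CKN_bubble[OF proper CKN C0' p0 l _ s0 k0 _ pk _ B borel AE])
           (use le in \<open>auto simp: s_def q_def k_def\<close>)
      also have "\<dots> \<le> ennreal ((C'\<^sup>2 * (s * k)\<^sup>2 * B) powr (1 / (1 - 2 / N)))"
        unfolding pN using N2 B C0' C' by (intro ennreal_leI powr_mono2 mult_right_mono power_mono) auto
      finally show "(\<integral>\<^sup>+x. ennreal (dist x\<^sub>0 x powr (- q) * (l + dist x\<^sub>0 x powr s) powr (- N)) \<partial>M)
          \<le> ennreal ((C'\<^sup>2 * (s * k)\<^sup>2 * B) powr (1 / (1 - 2 / N)))" .
    qed
    then obtain R where R: "R \<ge> R\<^sub>0" "ennreal (c * (v * R powr m)) < ennreal (measure M (ball x\<^sub>0 R))"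
      unfolding ball_eq em by auto
    then show ?thesis
      using R\<^sub>0 c v by (intro exI[of _ R]) (simp add: m_def powr_realpow ennreal_less_iff)
  qed

  have lower_c: "inverse C\<^sub>0 * c * (v * \<rho> ^ n) \<le> measure M (ball x \<rho>)"
    if c: "0 \<le> c" "c < (K / C) powr N" and \<rho>: "\<rho> > 0" for x c \<rho>
  proof -
    have Cpos: "C > 0" using C K by (simp add: K_def)
    \<comment> \<open>the remaining slack in \<open>c < (K / C) powr N\<close> leaves room for an admissible \<open>C' > C\<close>\<close>
    have "((\<lambda>C'. (K / C') powr N) \<longlongrightarrow> (K / C) powr N) (at_right C)"
      using Cpos K by (intro tendsto_intros) auto
    then have "eventually (\<lambda>C'. c < (K / C') powr N) (at_right C)" using c(2) by (rule order_tendstoD)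
    moreover have "eventually (\<lambda>C'. C' > C) (at_right C)" by (rule eventually_at_right_less)
    ultimately have "eventually (\<lambda>C'. c < (K / C') powr N \<and> C' > C) (at_right C)" by eventually_elim auto
    then obtain C' where C': "C' > C" "c < (K / C') powr N"
      using eventually_happens[of _ "at_right C"] by auto
    show ?thesis
      using measure_ball_ge_of_growth[OF borel fin _ _ \<rho> doubling', of "c * v" x\<^sub>0 x]
        growth[OF C'(1) c(1) C'(2)] C\<^sub>0 c v
      by (fastforce simp: mult.assoc intro: less_imp_le)
  qed
  have lower: "inverse C\<^sub>0 * (K / C) powr N * (v * \<rho> ^ n) \<le> measure M (ball x \<rho>)" if \<rho>: "\<rho> > 0" for x \<rho>
  proof (rule field_le_mult_one_interval)
    fix z :: real assume z: "0 < z" "z < 1"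
    have Cpos: "C > 0" using C K by (simp add: K_def)
    have "0 < (K / C) powr N" using K Cpos by simp
    then have "z * (K / C) powr N < (K / C) powr N" using z by simp
    then show "z * (inverse C\<^sub>0 * (K / C) powr N * (v * \<rho> ^ n)) \<le> measure M (ball x \<rho>)"
      using lower_c[of "z * (K / C) powr N" \<rho> x] z \<rho> by (simp add: mult_ac)
  qed
  show ?thesis
    unfolding N_def[symmetric] K_def[symmetric] v_def[symmetric]
    using lower upper by (simp add: vol_n divide_inverse mult_ac)
qed

end
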